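(* There exist $T>0$, a function $w\in W^{1,2}(-T,T)$, and a continuous function $\phi\colon[-T,T]\times\mathbb{R}\to[0,\infty)$ such that \[ \mathscr{L}(u)=\int_{-T}^{T}\Big(\phi\big(t,u(t)-w(t)\big)+(u'(t))^2\Big)\,dt \] defines a functional on $W^{1,1}(-T,T)$ with a continuous Lagrangian such that $w$ is a minimizer of $\mathscr{L}$ over $\mathscr{A}_{w(-T),w(T)}$, but $\overline{D}w(t)=+\infty$ and $\underline{D}w(t)=-\infty$ for a dense set of points $t\in[-T,T]$.
   Context: Functions in $W^{1,1}(-T,T)$ (real-valued) are identified with their absolutely continuous representatives on $[-T,T]$. For $A,B\in\mathbb{R}$, $\mathscr{A}_{A,B}=\{v\in W^{1,1}(-T,T): v(-T)=A,\ v(T)=B\}$. The functional $\mathscr{L}$ may take the value $+\infty$. A minimizer of $\mathscr{L}$ over $\mathscr{A}_{A,B}$ is an element $v\in\mathscr{A}_{A,B}$ with $\mathscr{L}(v)\le\mathscr{L}(u)$ for all $u\in\mathscr{A}_{A,B}$. The Lagrangian of $\mathscr{L}$ is the function $(t,y,p)\mapsto\phi(t,y-w(t))+p^2$ on $[-T,T]\times\mathbb{R}\times\mathbb{R}$. The upper and lower Dini derivatives of $v$ at $t\in(-T,T)$ are \[ \overline{D}v(t)=\limsup_{s\to t}\frac{v(s)-v(t)}{s-t},\qquad \underline{D}v(t)=\liminf_{s\to t}\frac{v(s)-v(t)}{s-t}. \] *)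

theory Defs
  imports "HOL-Analysis.Analysis"
begin

text \<open>
  Functions on an interval are represented by total functions on the reals; every notion below
  depends only on their values on the interval in question.
\<close>

text \<open>
  Absolute continuity in the \<open>\<epsilon>\<close>-\<open>\<delta>\<close> sense.  An element \<open>k\<close> of a division is a closed interval
  \<open>[Inf k, Sup k]\<close>, and distinct elements have disjoint interiors.
\<close>

definition abs_continuous_on :: "real set \<Rightarrow> (real \<Rightarrow> real) \<Rightarrow> bool" where
  "abs_continuous_on S f \<longleftrightarrow>
     (\<forall>\<epsilon>>0. \<exists>\<delta>>0. \<forall>D C. D division_of C \<and> C \<subseteq> S \<and> (\<Sum>k\<in>D. Sup k - Inf k) < \<delta>
        \<longrightarrow> (\<Sum>k\<in>D. \<bar>f (Sup k) - f (Inf k)\<bar>) < \<epsilon>)"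

definition mem_Lp :: "real \<Rightarrow> real \<Rightarrow> real \<Rightarrow> (real \<Rightarrow> real) \<Rightarrow> bool" where
  "mem_Lp p a b f \<longleftrightarrow>
     f \<in> borel_measurable (lebesgue_on {a<..<b}) \<and>
     integrable (lebesgue_on {a<..<b}) (\<lambda>t. \<bar>f t\<bar> powr p)"

text \<open>
  Weak derivatives on \<open>(a, b)\<close>, tested as in Brezis' book against continuously differentiable
  functions with compact support in \<open>(a, b)\<close>.
\<close>

definition test_function :: "real \<Rightarrow> real \<Rightarrow> (real \<Rightarrow> real) \<Rightarrow> bool" where
  "test_function a b \<psi> \<longleftrightarrow>
     (\<forall>t. \<psi> differentiable (at t)) \<and> continuous_on UNIV (deriv \<psi>) \<and>
     (\<exists>K. compact K \<and> K \<subseteq> {a<..<b} \<and> (\<forall>t. t \<notin> K \<longrightarrow> \<psi> t = 0))"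

definition has_weak_deriv :: "real \<Rightarrow> real \<Rightarrow> (real \<Rightarrow> real) \<Rightarrow> (real \<Rightarrow> real) \<Rightarrow> bool" where
  "has_weak_deriv a b v g \<longleftrightarrow>
     integrable (lebesgue_on {a<..<b}) v \<and> integrable (lebesgue_on {a<..<b}) g \<and>
     (\<forall>\<psi>. test_function a b \<psi> \<longrightarrow>
        (\<integral>t. v t * deriv \<psi> t \<partial>lebesgue_on {a<..<b}) = - (\<integral>t. g t * \<psi> t \<partial>lebesgue_on {a<..<b}))"

text \<open>
  A weak derivative is unique only up to null sets; it is used below only under integrals and
  in measurability statements for the (complete) Lebesgue measure, where the choice is immaterial.
\<close>

definition weak_deriv :: "real \<Rightarrow> real \<Rightarrow> (real \<Rightarrow> real) \<Rightarrow> real \<Rightarrow> real" where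
  "weak_deriv a b v = (SOME g. has_weak_deriv a b v g)"

text \<open>
  The space \<open>W\<^sup>1\<^sup>,\<^sup>p(a, b)\<close> for \<open>1 \<le> p < \<infinity>\<close>, each class being represented by its absolutely
  continuous representatives on \<open>[a, b]\<close>.
\<close>

definition sobolev :: "real \<Rightarrow> real \<Rightarrow> real \<Rightarrow> (real \<Rightarrow> real) set" where
  "sobolev p a b =
     {v. abs_continuous_on {a..b} v \<and> mem_Lp p a b v \<and>
         (\<exists>g. mem_Lp p a b g \<and> has_weak_deriv a b v g)}"

definition admissible :: "real \<Rightarrow> real \<Rightarrow> real \<Rightarrow> (real \<Rightarrow> real) set" where
  "admissible T A B = {v \<in> sobolev 1 (-T) T. v (-T) = A \<and> v T = B}"

text \<open>
  For a nonnegative Lagrangian \<open>F\<close> the integral functional always has a value in \<open>[0, \<infinity>]\<close>.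
  For a Lagrangian taking negative values the integrand would be truncated at 0.
\<close>

definition int_functional ::
    "real \<Rightarrow> (real \<times> real \<times> real \<Rightarrow> real) \<Rightarrow> (real \<Rightarrow> real) \<Rightarrow> ennreal" where
  "int_functional T F u =
     (\<integral>\<^sup>+t. ennreal (F (t, u t, weak_deriv (-T) T u t)) \<partial>lebesgue_on {-T<..<T})"

definition minimizer_over :: "('a \<Rightarrow> ennreal) \<Rightarrow> 'a set \<Rightarrow> 'a \<Rightarrow> bool" where
  "minimizer_over J X v \<longleftrightarrow> v \<in> X \<and> (\<forall>u\<in>X. J v \<le> J u)"

definition lagrangian ::
    "(real \<times> real \<Rightarrow> real) \<Rightarrow> (real \<Rightarrow> real) \<Rightarrow> real \<times> real \<times> real \<Rightarrow> real" where
  "lagrangian \<phi> w = (\<lambda>(t, y, p). \<phi> (t, y - w t) + p\<^sup>2)"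

definition upper_Dini :: "(real \<Rightarrow> real) \<Rightarrow> real \<Rightarrow> ereal" where
  "upper_Dini v t = Limsup (at t) (\<lambda>s. ereal ((v s - v t) / (s - t)))"

definition lower_Dini :: "(real \<Rightarrow> real) \<Rightarrow> real \<Rightarrow> ereal" where
  "lower_Dini v t = Liminf (at t) (\<lambda>s. ereal ((v s - v t) / (s - t)))"

end

theory Submission
  imports Defs "HOL-Real_Asymp.Real_Asymp"
begin

text \<open>
  Write a competitor as \<open>u = w + z\<close>.  If the penalty \<open>\<phi>\<close> vanishes for \<open>z = 0\<close>, then the energy of
  \<open>u\<close> exceeds that of \<open>w\<close> by the integral of \<open>\<phi> (t, z) + 2 w' z' + (z')\<^sup>2\<close>, and \<open>w\<close> is a
  minimizer as soon as this is never negative.  The condition is additive: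
  if \<open>w' = \<Sum>j. \<beta> j\<close> and if numbers \<open>\<alpha> j > 0\<close> with sum at most \<open>1\<close> satisfy

    the integral of \<open>\<phi>\<^sub>j (t, z) + 2 \<beta> j z' + \<alpha> j (z')\<^sup>2\<close> is nonnegative for every \<open>z\<close>,

  then \<open>\<phi> = \<Sum>j. \<phi>\<^sub>j\<close> is a suitable penalty.  For one smooth bump \<open>\<beta>\<close> of height \<open>c\<close>, supported
  in an interval of length \<open>L\<close>, the lemma \<open>single_bump_inequality\<close> shows that
  \<open>2 \<bar>\<beta>'\<bar> min \<bar>z\<bar> (4 c L / \<alpha>)\<close> is such a \<open>\<phi>\<^sub>j\<close>.  For \<open>\<beta>'\<close> of order \<open>c / L\<close> it is bounded by a
  multiple of \<open>c\<^sup>2 / \<alpha>\<close>, however short the interval is, and it vanishes wherever \<open>\<beta>\<close> is constant.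

  A singularity at one point is made from bumps of heights \<open>c k\<close> centred at that point and of
  radii \<open>4 ^ (- k)\<close>, each of them equal to its full height on half of its support.  The slope of
  \<open>w\<close> at scale \<open>4 ^ (- K)\<close> is then the partial sum \<open>\<Sum>k\<le>K. c k\<close> up to a bounded error, so the Dini
  derivatives are infinite when these partial sums are unbounded in both directions.  The
  penalties live on the flanks of the bumps, which are disjoint for different \<open>k\<close>.  Therefore
  their sum is continuous once the suprema, of order \<open>(c k)\<^sup>2 / a k\<close> for the weights \<open>a k\<close>,
  tend to \<open>0\<close>, even though the sum of these suprema is infinite.  Slowly oscillating partial sums
  with \<open>c k\<close> of order \<open>ln k / k\<close> and \<open>a k\<close> of order \<open>k powr (-3/2)\<close> meet all these demands
  (\<open>oscillating_series\<close>).

  Finally scaled copies are placed at all points \<open>q n\<close> of a dense sequence, with factors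
  \<open>2 ^ (- n - 1)\<close>, which again share out the quadratic energy.  If the radius of every copy is at
  most its distance to the earlier sites, the copies change the difference quotients at each other's
  sites by bounded amounts only (\<open>difference_quotient_estimate\<close>), and \<open>w\<close> is singular at
  every \<open>q n\<close>.
\<close>

section \<open>Smooth cut-off functions\<close>

text \<open>
  A quadratic spline rising from \<open>0\<close> at \<open>x \<le> 0\<close> to \<open>1\<close> at \<open>x \<ge> 1\<close>; its derivative is the
  tent of height \<open>2\<close> over \<open>[0, 1]\<close>.  Splines in the positive part keep every derivative and
  every primitive explicit on the whole line.
\<close>

definition step :: "real \<Rightarrow> real" where
  "step x = 2 * (max 0 x)\<^sup>2 - 4 * (max 0 (x - 1/2))\<^sup>2 + 2 * (max 0 (x - 1))\<^sup>2"

definition step' :: "real \<Rightarrow> real" where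
  "step' x = 4 * max 0 x - 8 * max 0 (x - 1/2) + 4 * max 0 (x - 1)"

lemma DERIV_pos_part_power:
  assumes "0 < n"
  shows "((\<lambda>x::real. (max 0 x) ^ Suc n) has_real_derivative real (Suc n) * (max 0 x) ^ n) (at x)"
proof (cases x "0::real" rule: linorder_cases)
  case less
  have "((\<lambda>x::real. 0) has_real_derivative real (Suc n) * (max 0 x) ^ n) (at x)"
    using less assms by (simp add: max_def power_0_left)
  then show ?thesis
    by (rule has_field_derivative_transform_within_open[where S="{..<0}"]) (use less in \<open>auto simp: max_def\<close>)
next
  case greater
  have "((\<lambda>x::real. x ^ Suc n) has_real_derivative real (Suc n) * (max 0 x) ^ n) (at x)"
    using greater DERIV_pow[of "Suc n" x] by (simp add: max_def)
  then show ?thesis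
    by (rule has_field_derivative_transform_within_open[where S="{0<..}"]) (use greater in \<open>auto simp: max_def\<close>)
next
  case equal
  have "((\<lambda>h::real. (max 0 h) ^ n) \<longlongrightarrow> (max 0 0) ^ n) (at 0)"
    by (intro tendsto_intros)
  moreover have "(max 0 h) ^ n = (max 0 (x + h) ^ Suc n - max 0 x ^ Suc n) / h" if "h \<noteq> 0" for h
    using that equal assms by (auto simp: max_def)
  ultimately have "((\<lambda>h. (max 0 (x + h) ^ Suc n - max 0 x ^ Suc n) / h) \<longlongrightarrow> (max 0 0) ^ n) (at 0)"
    by (elim Lim_transform_eventually) (auto simp: eventually_at_filter intro!: always_eventually)
  then show ?thesis
    using assms equal by (simp add: DERIV_def power_0_left)
qed

lemma DERIV_pos_part_power_shift:
  assumes "0 < n"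
  shows "((\<lambda>x::real. (max 0 (x - a)) ^ Suc n) has_real_derivative real (Suc n) * (max 0 (x - a)) ^ n) (at x)"
proof -
  have "((\<lambda>x. x - a) has_real_derivative 1) (at x)"
    by (auto intro!: derivative_eq_intros)
  from DERIV_chain2[OF DERIV_pos_part_power[OF assms] this] show ?thesis
    by simp
qed

lemma DERIV_step: "(step has_real_derivative step' x) (at x)"
proof -
  have *: "((\<lambda>x::real. (max 0 (x - a))\<^sup>2) has_real_derivative 2 * max 0 (x - a)) (at x)" for a
    using DERIV_pos_part_power_shift[of 1 a x] by (simp add: numeral_2_eq_2)
  show ?thesis
    unfolding step_def[abs_def] step'_def
    by (rule derivative_eq_intros *[of 0, simplified] * refl)+ simp
qed

lemma continuous_on_step': "continuous_on S step'"
  unfolding step'_def[abs_def] by (intro continuous_intros)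

lemma step'_bounds: "0 \<le> step' x" "step' x \<le> 2"
  by (auto simp: step'_def max_def)

lemma step'_eq_0: "x \<le> 0 \<or> 1 \<le> x \<Longrightarrow> step' x = 0"
  by (auto simp: step'_def max_def)

lemma step_eq_0: "x \<le> 0 \<Longrightarrow> step x = 0"
  by (auto simp: step_def max_def)

lemma step_eq_1: "1 \<le> x \<Longrightarrow> step x = 1"
  by (auto simp: step_def max_def power2_eq_square algebra_simps)

lemma mono_step: "x \<le> y \<Longrightarrow> step x \<le> step y"
  by (rule DERIV_nonneg_imp_nondecreasing) (auto intro: DERIV_step step'_bounds)

lemma step_bounds: "0 \<le> step x" "step x \<le> 1"
  using mono_step[of "min 0 x" x] mono_step[of x "max 1 x"]
  by (auto simp: step_eq_0 step_eq_1)

text \<open>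
  Rises from \<open>0\<close> to \<open>1\<close> on \<open>[s, s + e]\<close> and falls back to \<open>0\<close> on \<open>[t, t + e]\<close>.  These are the
  test functions that approximate the indicator of \<open>(s, t]\<close>, and one of them is the basic bump.
\<close>

definition plateau :: "real \<Rightarrow> real \<Rightarrow> real \<Rightarrow> real \<Rightarrow> real" where
  "plateau s t e x = step ((x - s) / e) - step ((x - t) / e)"

definition plateau' :: "real \<Rightarrow> real \<Rightarrow> real \<Rightarrow> real \<Rightarrow> real" where
  "plateau' s t e x = step' ((x - s) / e) / e - step' ((x - t) / e) / e"

lemma DERIV_plateau: "0 < e \<Longrightarrow> (plateau s t e has_real_derivative plateau' s t e x) (at x)"
  unfolding plateau_def[abs_def] plateau'_def
  by (auto intro!: derivative_eq_intros DERIV_chain2[OF DERIV_step])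

lemma continuous_on_plateau': "0 < e \<Longrightarrow> continuous_on S (plateau' s t e)"
  unfolding plateau'_def[abs_def]
  by (intro continuous_intros continuous_on_compose2[OF continuous_on_step'[of UNIV]]) auto

lemma plateau_eq_0:
  "0 < e \<Longrightarrow> s \<le> t \<Longrightarrow> x \<notin> {s..t+e} \<Longrightarrow> plateau s t e x = 0"
  by (cases "x < s") (auto simp: plateau_def step_eq_0 step_eq_1 field_simps)

lemma plateau_bounds:
  assumes "0 < e" "s + e \<le> t"
  shows "0 \<le> plateau s t e x" "plateau s t e x \<le> 1"
  using assms step_bounds[of "(x - s) / e"] step_bounds[of "(x - t) / e"]
  by (cases "x \<le> t"; auto simp: plateau_def step_eq_0 step_eq_1 field_simps)+

lemma test_functionI:
  assumes "\<And>t. (\<psi> has_real_derivative \<psi>' t) (at t)" "continuous_on UNIV \<psi>'"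
    and "a < l" "r < b" "\<And>t. t \<notin> {l..r} \<Longrightarrow> \<psi> t = 0"
  shows "test_function a b \<psi>"
proof -
  have "deriv \<psi> = \<psi>'"
    using assms(1) by (auto intro: DERIV_imp_deriv)
  then show ?thesis
    unfolding test_function_def using assms
    by (auto intro!: exI[of _ "{l..r}"] simp: real_differentiable_def)
qed

lemma test_function_plateau:
  assumes "0 < e" "s \<le> t" "a < s" "t + e < b"
  shows "test_function a b (plateau s t e)"
  by (rule test_functionI[OF DERIV_plateau continuous_on_plateau' _ _ plateau_eq_0])
     (use assms in auto)

lemma test_functionD:
  assumes "test_function a b \<psi>"
  shows "(\<psi> has_real_derivative deriv \<psi> t) (at t)"
    and "continuous_on UNIV \<psi>" "continuous_on UNIV (deriv \<psi>)"
proof -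
  show d: "(\<psi> has_real_derivative deriv \<psi> t) (at t)" for t
    using assms DERIV_deriv_iff_real_differentiable unfolding test_function_def by blast
  show "continuous_on UNIV \<psi>" "continuous_on UNIV (deriv \<psi>)"
    using d assms by (auto simp: test_function_def intro!: DERIV_isCont continuous_at_imp_continuous_on)
qed

section \<open>Lebesgue integrals over an open interval\<close>

lemma borel_measurable_lebesgue_on_borel:
  fixes f :: "real \<Rightarrow> real"
  assumes "f \<in> borel_measurable borel"
  shows "f \<in> borel_measurable (lebesgue_on S)"
  by (rule measurable_restrict_space1) (simp add: assms measurable_completion)

lemma integral_lebesgue_on_borel:
  fixes f :: "real \<Rightarrow> real"
  assumes "f \<in> borel_measurable borel" "S \<in> sets borel"
  shows "integral\<^sup>L (lebesgue_on S) f = (\<integral>x. indicator S x * f x \<partial>lborel)"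
    and "integrable (lebesgue_on S) f \<longleftrightarrow> integrable lborel (\<lambda>x. indicator S x * f x)"
proof -
  have "S \<inter> space lebesgue \<in> sets lebesgue"
    using assms by auto
  moreover have "(\<lambda>x. indicator S x * f x) \<in> borel_measurable lborel"
    using assms by auto
  ultimately show "integral\<^sup>L (lebesgue_on S) f = (\<integral>x. indicator S x * f x \<partial>lborel)"
    "integrable (lebesgue_on S) f \<longleftrightarrow> integrable lborel (\<lambda>x. indicator S x * f x)"
    by (simp_all add: integral_restrict_space integral_completion integrable_restrict_space
        integrable_completion)
qed

lemma integrable_bounded_lebesgue_on:
  fixes f :: "real \<Rightarrow> real"
  assumes "f \<in> borel_measurable (lebesgue_on {a<..<b})" "\<And>x. x \<in> {a<..<b} \<Longrightarrow> \<bar>f x\<bar> \<le> C"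
  shows "integrable (lebesgue_on {a<..<b}) f"
proof -
  interpret finite_measure "lebesgue_on {a<..<b}"
    by (rule finite_measure_lebesgue_on) simp
  show ?thesis
    using assms by (intro integrable_const_bound[where B=C]) auto
qed

lemma bounded_on_interval_of_continuous:
  fixes h :: "real \<Rightarrow> real"
  assumes "continuous_on UNIV h"
  obtains C where "\<And>t. t \<in> {a<..<b} \<Longrightarrow> \<bar>h t\<bar> \<le> C"
proof -
  have "bounded (h ` {a..b})"
    using assms by (intro compact_imp_bounded compact_continuous_image) (auto intro: continuous_on_subset)
  then obtain C where C: "\<forall>y\<in>h ` {a..b}. norm y \<le> C" unfolding bounded_iff by blast
  show ?thesis by (rule that[of C]) (use C in auto)
qed

lemma integrable_continuous_lebesgue_on:
  fixes h :: "real \<Rightarrow> real"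
  assumes "continuous_on UNIV h"
  shows "integrable (lebesgue_on {a<..<b}) h"
proof -
  obtain C where C: "\<And>t. t \<in> {a<..<b} \<Longrightarrow> \<bar>h t\<bar> \<le> C"
    using bounded_on_interval_of_continuous[OF assms] by blast
  show ?thesis
    using assms C
    by (intro integrable_bounded_lebesgue_on[where C=C] borel_measurable_lebesgue_on_borel
        borel_measurable_continuous_onI)
qed

lemma integral_FTC_lebesgue_on:
  fixes f F :: "real \<Rightarrow> real"
  assumes "a \<le> s" "s \<le> t" "t \<le> b"
    and F: "\<And>x. (F has_real_derivative f x) (at x)" and f: "continuous_on UNIV f"
  shows "integral\<^sup>L (lebesgue_on {a<..<b}) (\<lambda>x. indicator {s<..t} x * f x) = F t - F s"
proof -
  have [measurable]: "f \<in> borel_measurable borel"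
    using f by (rule borel_measurable_continuous_onI)
  have "AE x in lborel. x \<noteq> s \<and> x \<noteq> t"
    using AE_lborel_singleton[of s] AE_lborel_singleton[of t] by eventually_elim auto
  then have ae: "AE x in lborel. indicator {a<..<b} x * (indicator {s<..t} x * f x) = f x * indicator {s..t} x"
    by eventually_elim (use assms in \<open>auto simp: indicator_def\<close>)
  have "integral\<^sup>L (lebesgue_on {a<..<b}) (\<lambda>x. indicator {s<..t} x * f x)
      = (\<integral>x. f x * indicator {s..t} x \<partial>lborel)"
    using ae by (subst integral_lebesgue_on_borel) (auto intro!: integral_cong_AE simp del: indicator_simps)
  also have "\<dots> = F t - F s"
    by (rule integral_FTC_Icc_real)
       (use assms f in \<open>auto simp: continuous_on_eq_continuous_at\<close>)
  finally show ?thesis .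
qed

text \<open>
  The sets over which \<open>h\<close> integrates to \<open>0\<close> form a Dynkin system, and the half-lines
  \<open>{..t}\<close> are stable under intersection and generate the Borel sets.
\<close>

lemma AE_zero_of_interval_integrals:
  fixes h :: "real \<Rightarrow> real"
  assumes h: "integrable lborel h" and 0: "integral\<^sup>L lborel h = 0"
    and z: "\<And>t. (\<integral>x. indicator {..t} x * h x \<partial>lborel) = 0"
  shows "AE x in lborel. h x = 0"
proof (rule sigma_finite_measure.density_zero[OF lborel.sigma_finite_measure_axioms h])
  fix A :: "real set" assume A: "A \<in> sets lborel"
  have int: "set_integrable lborel A h" if "A \<in> sets borel" for A
    using that h unfolding set_integrable_def by (intro integrable_mult_indicator) auto
  have [simp]: "sigma_sets UNIV (range (\<lambda>a::real. {..a})) = sets borel"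
    by (simp add: borel_eq_atMost)
  have "Int_stable (range (\<lambda>a::real. {..a}))"
  proof (rule Int_stableI)
    fix X Y :: "real set" assume "X \<in> range atMost" "Y \<in> range atMost"
    then obtain x y where "X = {..x}" "Y = {..y}" by auto
    then have "X \<inter> Y = {..min x y}" by auto
    then show "X \<inter> Y \<in> range atMost" by auto
  qed
  moreover have "range (\<lambda>a::real. {..a}) \<subseteq> Pow UNIV" by auto
  moreover have "A \<in> sigma_sets UNIV (range (\<lambda>a::real. {..a}))" using A by simp
  ultimately show "set_lebesgue_integral lborel A h = 0"
  proof (induction A rule: sigma_sets_induct_disjoint)
    case (basic A)
    then show ?case using z by (auto simp: set_lebesgue_integral_def)
  next
    case empty
    then show ?case by (simp add: set_lebesgue_integral_def)
  next
    case (compl A)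
    then have A: "A \<in> sets borel" by simp
    have "(LINT x:UNIV|lborel. h x) = (LINT x:A|lborel. h x) + (LINT x:UNIV - A|lborel. h x)"
      using set_integral_Un[OF _ int[of A] int[of "UNIV - A"]] A by auto
    then show ?case using compl 0 by (simp add: set_lebesgue_integral_def)
  next
    case (union A)
    then have "\<And>i. A i \<in> sets borel" by auto
    then have "(LINT x:(\<Union>i. A i)|lborel. h x) = (\<Sum>i. (LINT x:(A i)|lborel. h x))"
      using union by (intro lebesgue_integral_countable_add int) (auto simp: disjoint_family_on_def)
    then show ?case using union by simp
  qed
qed

lemma integrable_mult_bounded:
  fixes f h :: "'a \<Rightarrow> real"
  assumes "integrable M f" "h \<in> borel_measurable M" "\<And>x. x \<in> space M \<Longrightarrow> \<bar>h x\<bar> \<le> C"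
  shows "integrable M (\<lambda>x. f x * h x)"
proof (rule Bochner_Integration.integrable_bound)
  show "integrable M (\<lambda>x. C * \<bar>f x\<bar>)"
    using assms(1) by auto
  show "(\<lambda>x. f x * h x) \<in> borel_measurable M"
    using assms(1,2) by auto
  show "AE x in M. norm (f x * h x) \<le> norm (C * \<bar>f x\<bar>)"
  proof (rule AE_I2)
    fix x assume "x \<in> space M"
    then have "\<bar>h x\<bar> \<le> \<bar>C\<bar>" using assms(3) by fastforce
    then show "norm (f x * h x) \<le> norm (C * \<bar>f x\<bar>)"
      using mult_left_mono[of "\<bar>h x\<bar>" "\<bar>C\<bar>" "\<bar>f x\<bar>"] by (simp add: abs_mult mult.commute)
  qed
qed

lemma borel_measurable_indicator_lebesgue_on:
  "A \<in> sets borel \<Longrightarrow> (indicator A :: real \<Rightarrow> real) \<in> borel_measurable (lebesgue_on S)"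
  by (rule borel_measurable_lebesgue_on_borel) auto

lemma integral_indicator_lebesgue_on:
  fixes l r :: real
  assumes "a < l" "l < r" "r < b"
  shows "integrable (lebesgue_on {a<..<b}) (indicator {l..r} :: real \<Rightarrow> real)"
    and "(\<integral>x. indicator {l..r} x \<partial>lebesgue_on {a<..<b}) = r - l"
proof -
  have m: "(indicator {l..r} :: real \<Rightarrow> real) \<in> borel_measurable (lebesgue_on {a<..<b})"
    by (rule borel_measurable_indicator_lebesgue_on) simp
  show "integrable (lebesgue_on {a<..<b}) (indicator {l..r} :: real \<Rightarrow> real)"
    by (rule integrable_bounded_lebesgue_on[OF m, where C=1]) (auto simp: indicator_def)
  have "(\<lambda>x. indicator {a<..<b} x * indicator {l..r} x) = (indicator {l..r} :: real \<Rightarrow> real)"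
    using assms by (auto simp: indicator_def)
  then show "(\<integral>x. indicator {l..r} x \<partial>lebesgue_on {a<..<b}) = r - l"
    using assms by (subst integral_lebesgue_on_borel) simp_all
qed

section \<open>Weak derivatives on an interval\<close>

text \<open>
  The functions \<open>K n\<close> are nonnegative with integral \<open>1\<close> and live on \<open>[s, s + e n]\<close>, so they
  concentrate at \<open>s\<close>.
\<close>

lemma step_kernel_tendsto:
  fixes a b s :: real and e :: "nat \<Rightarrow> real"
  defines "K \<equiv> \<lambda>n x. step' ((x - s) / e n) / e n"
  assumes v: "integrable (lebesgue_on {a<..<b}) v" "continuous_on {a<..<b} v"
    and s: "a < s" "s < b" and e: "\<And>n. 0 < e n" "e \<longlonglongrightarrow> 0"
  shows "(\<lambda>n. \<integral>x. v x * K n x \<partial>lebesgue_on {a<..<b}) \<longlonglongrightarrow> v s"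
proof (rule LIMSEQ_I)
  let ?M = "lebesgue_on {a<..<b}"
  fix r :: real assume r: "0 < r"
  have "isCont v s"
    using v(2) s by (simp add: continuous_on_eq_continuous_at)
  then obtain d where d: "0 < d" "\<And>x. \<bar>x - s\<bar> < d \<Longrightarrow> \<bar>v x - v s\<bar> < r / 2"
    using r unfolding continuous_at_eps_delta dist_real_def by (metis half_gt_zero)
  have "eventually (\<lambda>n. e n < min d (b - s)) sequentially"
    using e(2) d s by (intro order_tendstoD) auto
  then obtain N where N: "\<And>n. n \<ge> N \<Longrightarrow> e n < min d (b - s)"
    by (auto simp: eventually_sequentially)
  have "norm ((\<integral>x. v x * K n x \<partial>?M) - v s) < r" if n: "n \<ge> N" for n
  proof -
    have en: "0 < e n" "e n < d" "s + e n < b" using N[OF n] e(1) by auto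
    have cK: "continuous_on UNIV (K n)"
      unfolding K_def using en
      by (intro continuous_intros continuous_on_compose2[OF continuous_on_step'[of UNIV]]) auto
    have dK: "((\<lambda>x. step ((x - s) / e n)) has_real_derivative K n x) (at x)" for x
    proof -
      have "((\<lambda>x. (x - s) / e n) has_real_derivative 1 / e n) (at x)"
        using en by (auto intro!: derivative_eq_intros)
      from DERIV_chain2[OF DERIV_step this] show ?thesis by (simp add: K_def)
    qed
    have [measurable]: "K n \<in> borel_measurable ?M"
      by (intro borel_measurable_lebesgue_on_borel borel_measurable_continuous_onI cK)
    have Kb: "0 \<le> K n x" "\<bar>K n x\<bar> \<le> 2 / e n" for x
      unfolding K_def using step'_bounds[of "(x - s) / e n"] en by (auto simp: divide_right_mono)
    have K0: "K n x = 0" if "x \<notin> {s<..s + e n}" for x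
      using that en by (auto simp: K_def step'_eq_0 field_simps)
    have iK: "integrable ?M (K n)"
      using Kb by (intro integrable_bounded_lebesgue_on) auto
    have "(\<integral>x. K n x \<partial>?M) = (\<integral>x. indicator {s<..s+e n} x * K n x \<partial>?M)"
      using K0 by (intro Bochner_Integration.integral_cong) (fastforce simp: indicator_def)+
    also have "\<dots> = (\<lambda>x. step ((x - s) / e n)) (s + e n) - (\<lambda>x. step ((x - s) / e n)) s"
      using s en by (intro integral_FTC_lebesgue_on cK)
        (auto intro!: dK)
    finally have K1: "(\<integral>x. K n x \<partial>?M) = 1"
      using en by (simp add: step_eq_0 step_eq_1)
    have ivK: "integrable ?M (\<lambda>x. v x * K n x)"
      using v(1) Kb by (intro integrable_mult_bounded) auto
    have "(\<integral>x. v x * K n x \<partial>?M) - v s = (\<integral>x. v x * K n x - v s * K n x \<partial>?M)"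
      using iK ivK K1 by (subst Bochner_Integration.integral_diff) auto
    moreover have "\<bar>\<integral>x. v x * K n x - v s * K n x \<partial>?M\<bar> \<le> (\<integral>x. r / 2 * K n x \<partial>?M)"
    proof (rule order_trans[OF integral_abs_bound], rule integral_mono)
      show "\<bar>v x * K n x - v s * K n x\<bar> \<le> r / 2 * K n x" if "x \<in> space ?M" for x
      proof (cases "x \<in> {s<..s + e n}")
        case True
        then have "\<bar>v x - v s\<bar> \<le> r / 2" using d(2)[of x] en by auto
        then show ?thesis
          using mult_right_mono[OF _ Kb(1), of "\<bar>v x - v s\<bar>" "r / 2" x] Kb(1)[of x]
          by (metis abs_mult abs_of_nonneg left_diff_distrib)
      qed (simp add: K0)
    qed (use iK ivK in auto)
    ultimately show ?thesis using K1 r by simp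
  qed
  then show "\<exists>no. \<forall>n\<ge>no. norm ((\<integral>x. v x * K n x \<partial>?M) - v s) < r"
    by blast
qed

lemma has_weak_derivD:
  assumes "has_weak_deriv a b v g"
  shows "integrable (lebesgue_on {a<..<b}) v" "integrable (lebesgue_on {a<..<b}) g"
  using assms by (auto simp: has_weak_deriv_def)

lemma has_weak_derivD_test:
  assumes "has_weak_deriv a b v g" "test_function a b \<psi>"
    and "\<And>t. (\<psi> has_real_derivative \<psi>' t) (at t)"
  shows "(\<integral>t. v t * \<psi>' t \<partial>lebesgue_on {a<..<b}) = - (\<integral>t. g t * \<psi> t \<partial>lebesgue_on {a<..<b})"
proof -
  have "deriv \<psi> = \<psi>'"
    using assms(3) by (auto intro: DERIV_imp_deriv)
  then show ?thesis
    using assms(1,2) unfolding has_weak_deriv_def by blast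
qed

text \<open>
  The lemma of du Bois-Reymond.  Testing the weak derivative with plateaus whose flanks shrink
  to \<open>s\<close> and \<open>t\<close> turns one side of the defining identity into \<open>v s - v t\<close>, by concentration of
  the kernels, and the other into minus the integral of \<open>g\<close> over \<open>(s, t]\<close>, by dominated convergence.
\<close>

lemma has_weak_deriv_FTC:
  assumes wd: "has_weak_deriv a b v g" and cont: "continuous_on {a<..<b} v"
    and st: "a < s" "s \<le> t" "t < b"
  shows "v t - v s = (\<integral>x. indicator {s<..t} x * g x \<partial>lebesgue_on {a<..<b})"
proof -
  let ?M = "lebesgue_on {a<..<b}"
  note wdD = has_weak_derivD[OF wd]
  note [measurable] = wdD(2)[THEN borel_measurable_integrable]
  define e where "e n = (b - t) / (real n + 2)" for n :: nat
  have e0: "0 < e n" for n using st by (simp add: e_def)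
  have eb: "t + e n < b" for n
  proof -
    have "e n \<le> (b - t) / 2"
      unfolding e_def using st by (intro divide_left_mono) auto
    then show ?thesis using st by argo
  qed
  have e: "e \<longlonglongrightarrow> 0"
    unfolding e_def by real_asymp
  define K where "K u n x = step' ((x - u) / e n) / e n" for u n x
  have Kb: "\<bar>K u n x\<bar> \<le> 2 / e n" for u n x
    unfolding K_def using step'_bounds[of "(x - u) / e n"] e0[of n] by (auto simp: divide_right_mono)
  have [measurable]: "K u n \<in> borel_measurable ?M" for u n
    unfolding K_def using e0[of n]
    by (intro borel_measurable_lebesgue_on_borel borel_measurable_continuous_onI continuous_intros
        continuous_on_compose2[OF continuous_on_step'[of UNIV]]) auto
  have ivK: "integrable ?M (\<lambda>x. v x * K u n x)" for u n
    by (rule integrable_mult_bounded[OF wdD(1) _ Kb]) auto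
  have "(\<lambda>n. (\<integral>x. v x * K s n x \<partial>?M) - (\<integral>x. v x * K t n x \<partial>?M)) \<longlonglongrightarrow> v s - v t"
    unfolding K_def by (intro tendsto_diff step_kernel_tendsto wdD cont e e0) (use st in auto)
  also have "(\<lambda>n. (\<integral>x. v x * K s n x \<partial>?M) - (\<integral>x. v x * K t n x \<partial>?M))
      = (\<lambda>n. - (\<integral>x. g x * plateau s t (e n) x \<partial>?M))"
  proof
    fix n
    have "(\<integral>x. v x * K s n x \<partial>?M) - (\<integral>x. v x * K t n x \<partial>?M)
        = (\<integral>x. v x * plateau' s t (e n) x \<partial>?M)"
      using ivK by (subst Bochner_Integration.integral_diff[symmetric])
        (auto simp: plateau'_def K_def right_diff_distrib)
    also have "\<dots> = - (\<integral>x. g x * plateau s t (e n) x \<partial>?M)"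
      using st eb e0 by (intro has_weak_derivD_test[OF wd] test_function_plateau DERIV_plateau) auto
    finally show "(\<integral>x. v x * K s n x \<partial>?M) - (\<integral>x. v x * K t n x \<partial>?M)
        = - (\<integral>x. g x * plateau s t (e n) x \<partial>?M)" .
  qed
  finally have lim1: "(\<lambda>n. \<integral>x. g x * plateau s t (e n) x \<partial>?M) \<longlonglongrightarrow> v t - v s"
    using tendsto_minus by fastforce
  have "(\<lambda>n. \<integral>x. g x * plateau s t (e n) x \<partial>?M) \<longlonglongrightarrow> (\<integral>x. g x * indicator {s<..t} x \<partial>?M)"
  proof (rule integral_dominated_convergence[where w="\<lambda>x. \<bar>g x\<bar>"])
    have "plateau s t (e n) \<in> borel_measurable borel" for n
      using DERIV_plateau[OF e0]
      by (intro borel_measurable_continuous_onI) (auto intro!: DERIV_isCont continuous_at_imp_continuous_on)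
    then have [measurable]: "plateau s t (e n) \<in> borel_measurable ?M" for n
      by (rule borel_measurable_lebesgue_on_borel)
    show "(\<lambda>x. g x * plateau s t (e n) x) \<in> borel_measurable ?M" for n
      by measurable
    have pl: "\<bar>plateau s t (e n) x\<bar> \<le> 1" for n x
      using step_bounds[of "(x - s) / e n"] step_bounds[of "(x - t) / e n"] unfolding plateau_def
      by linarith
    show "(\<lambda>x. g x * indicator {s<..t} x) \<in> borel_measurable ?M"
      using wdD(2)[THEN borel_measurable_integrable]
      by (intro borel_measurable_times borel_measurable_indicator_lebesgue_on) simp_all
    show "AE x in ?M. norm (g x * plateau s t (e n) x) \<le> \<bar>g x\<bar>" for n
      using pl[of n] by (auto simp: abs_mult intro!: mult_left_le)
    have "(\<lambda>n. plateau s t (e n) x) \<longlonglongrightarrow> indicator {s<..t} x" for x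
    proof -
      have *: "(\<lambda>n. step ((x - u) / e n)) \<longlonglongrightarrow> indicator {u<..} x" for u
      proof (cases "u < x")
        case True
        then have "eventually (\<lambda>n. e n < x - u) sequentially"
          using e by (intro order_tendstoD) auto
        then have "eventually (\<lambda>n. 1 = step ((x - u) / e n)) sequentially"
          by eventually_elim (use e0 in \<open>auto simp: step_eq_1 field_simps less_imp_le\<close>)
        then show ?thesis using True by (auto intro: Lim_transform_eventually)
      next
        case False
        then show ?thesis using e0 by (simp add: step_eq_0 divide_nonpos_pos)
      qed
      have "indicator {s<..t} x = (indicator {s<..} x - indicator {t<..} x :: real)"
        using st by (auto simp: indicator_def)
      then show ?thesis
        unfolding plateau_def by (auto intro!: tendsto_diff *)
    qed
    then show "AE x in ?M. (\<lambda>n. g x * plateau s t (e n) x) \<longlonglongrightarrow> g x * indicator {s<..t} x"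
      by (intro AE_I2 tendsto_mult tendsto_const)
  qed (use wdD in auto)
  from LIMSEQ_unique[OF lim1 this] show ?thesis
    by (simp add: mult.commute)
qed

lemma has_weak_deriv_diff:
  assumes "has_weak_deriv a b u f" "has_weak_deriv a b v g"
  shows "has_weak_deriv a b (\<lambda>t. u t - v t) (\<lambda>t. f t - g t)"
  unfolding has_weak_deriv_def
proof (intro conjI allI impI)
  let ?M = "lebesgue_on {a<..<b}"
  note D = has_weak_derivD[OF assms(1)] has_weak_derivD[OF assms(2)]
  show "integrable ?M (\<lambda>t. u t - v t)" "integrable ?M (\<lambda>t. f t - g t)"
    using D by auto
  fix \<psi> assume \<psi>: "test_function a b \<psi>"
  note d = test_functionD(1)[OF \<psi>] and c = test_functionD(2,3)[OF \<psi>]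
  have int: "integrable ?M (\<lambda>t. h t * k t)" if h: "integrable ?M h" and k: "continuous_on UNIV k" for h k :: "real \<Rightarrow> real"
  proof -
    obtain C where C: "\<And>t. t \<in> {a<..<b} \<Longrightarrow> \<bar>k t\<bar> \<le> C"
      using bounded_on_interval_of_continuous[OF k] by blast
    show ?thesis
      by (rule integrable_mult_bounded[OF h, where C=C])
        (use C k in \<open>auto intro!: borel_measurable_lebesgue_on_borel borel_measurable_continuous_onI\<close>)
  qed
  show "(\<integral>t. (u t - v t) * deriv \<psi> t \<partial>?M) = - (\<integral>t. (f t - g t) * \<psi> t \<partial>?M)"
    using has_weak_derivD_test[OF assms(1) \<psi> d] has_weak_derivD_test[OF assms(2) \<psi> d]
      int[OF D(1) c(2)] int[OF D(3) c(2)] int[OF D(2) c(1)] int[OF D(4) c(1)]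
    by (simp add: left_diff_distrib)
qed

text \<open>
  The difference of two weak derivatives of \<open>v\<close> is a weak derivative of \<open>0\<close>, so all its integrals
  over intervals \<open>(s, t]\<close> vanish.
\<close>

lemma has_weak_deriv_unique:
  assumes "has_weak_deriv a b v f" "has_weak_deriv a b v g"
  shows "AE x in lebesgue_on {a<..<b}. f x = g x"
proof -
  let ?M = "lebesgue_on {a<..<b}"
  define h where "h x = f x - g x" for x
  have wd: "has_weak_deriv a b (\<lambda>t. 0) h"
    using has_weak_deriv_diff[OF assms] by (simp add: h_def[abs_def])
  note ih = has_weak_derivD(2)[OF wd]
  have st: "(\<integral>x. indicator {s<..t} x * h x \<partial>?M) = 0" if "a < s" "s \<le> t" "t < b" for s t
    using has_weak_deriv_FTC[OF wd _ that] by simp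
  have at: "(\<integral>x. indicator {a<..<t} x * h x \<partial>?M) = 0" if "a < t" "t \<le> b" for t
  proof -
    define d where "d n = (t - a) / (real n + 3)" for n :: nat
    have d: "d n > 0" "a + d n \<le> t - d n" for n
    proof -
      show "d n > 0" using that by (simp add: d_def)
      have "d n \<le> (t - a) / 3"
        unfolding d_def using that by (intro divide_left_mono) auto
      then show "a + d n \<le> t - d n" using that by argo
    qed
    have dl: "d \<longlonglongrightarrow> 0" unfolding d_def by real_asymp
    have "(\<lambda>n. \<integral>x. indicator {a + d n<..t - d n} x * h x \<partial>?M) \<longlonglongrightarrow> (\<integral>x. indicator {a<..<t} x * h x \<partial>?M)"
    proof (rule integral_dominated_convergence[where w="\<lambda>x. \<bar>h x\<bar>"])
      have "(\<lambda>n. indicator {a + d n<..t - d n} x) \<longlonglongrightarrow> (indicator {a<..<t} x :: real)" for x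
      proof (cases "a < x \<and> x < t")
        case True
        then have "eventually (\<lambda>n. d n < min (x - a) (t - x)) sequentially"
          using dl by (intro order_tendstoD) auto
        then have "eventually (\<lambda>n. 1 = (indicator {a + d n<..t - d n} x :: real)) sequentially"
          by eventually_elim auto
        then show ?thesis using True by (auto intro: Lim_transform_eventually)
      next
        case False
        then have "indicator {a + d n<..t - d n} x = (0::real)"
          for n using d(1)[of n] by (auto simp: indicator_def)
        then show ?thesis using False by auto
      qed
      then show "AE x in ?M. (\<lambda>n. indicator {a + d n<..t - d n} x * h x) \<longlonglongrightarrow> indicator {a<..<t} x * h x"
        by (intro AE_I2 tendsto_mult tendsto_const)
      show "AE x in ?M. norm (indicator {a + d n<..t - d n} x * h x) \<le> \<bar>h x\<bar>" for n
        by (auto simp: indicator_def)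
      show "(\<lambda>x. indicator {a<..<t} x * h x) \<in> borel_measurable ?M"
        "(\<lambda>x. indicator {a + d n<..t - d n} x * h x) \<in> borel_measurable ?M" for n
        using ih by (intro borel_measurable_times borel_measurable_indicator_lebesgue_on; simp)+
    qed (use ih in simp)
    moreover have "(\<integral>x. indicator {a + d n<..t - d n} x * h x \<partial>?M) = 0" for n
      using d[of n] that by (intro st) auto
    ultimately show ?thesis by (simp add: LIMSEQ_const_iff)
  qed
  \<comment> \<open>The half-lines generate only the Borel sets, hence the passage to a Borel version of \<open>h\<close>.\<close>
  have il: "integrable lebesgue (\<lambda>x. indicator {a<..<b} x * h x)"
    using ih by (simp add: integrable_restrict_space)
  then obtain h' where h': "h' \<in> borel_measurable lborel" "AE x in lborel. indicator {a<..<b} x * h x = h' x"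
    using completion_ex_borel_measurable_real[OF borel_measurable_integrable] by blast
  have ae: "AE x in lebesgue. indicator {a<..<b} x * h x = h' x"
    using h'(2) by (rule AE_completion)
  have h'm: "h' \<in> borel_measurable lebesgue" using h'(1) by (rule measurable_completion)
  have int: "(\<integral>x. indicator A x * h' x \<partial>lborel) = (\<integral>x. indicator (A \<inter> {a<..<b}) x * h x \<partial>?M)"
    if "A \<in> sets borel" for A
  proof -
    have [measurable]: "A \<in> sets lebesgue" using that by auto
    have "(\<integral>x. indicator A x * h' x \<partial>lborel) = (\<integral>x. indicator A x * h' x \<partial>lebesgue)"
      using that h' by (intro integral_completion[symmetric]) auto
    also have "\<dots> = (\<integral>x. indicator {a<..<b} x *\<^sub>R (indicator (A \<inter> {a<..<b}) x * h x) \<partial>lebesgue)"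
    proof (rule integral_cong_AE)
      show "AE x in lebesgue. indicator A x * h' x = indicator {a<..<b} x *\<^sub>R (indicator (A \<inter> {a<..<b}) x * h x)"
        using ae by eventually_elim (auto simp: indicator_def split: if_splits)
      have "(\<lambda>x. indicator {a<..<b} x *\<^sub>R (indicator (A \<inter> {a<..<b}) x * h x))
          = (\<lambda>x. indicator A x * (indicator {a<..<b} x * h x))"
        by (auto simp: indicator_def)
      then show "(\<lambda>x. indicator {a<..<b} x *\<^sub>R (indicator (A \<inter> {a<..<b}) x * h x)) \<in> borel_measurable lebesgue"
        using il by (auto intro!: borel_measurable_times borel_measurable_indicator)
    qed (use h'm in auto)
    also have "\<dots> = (\<integral>x. indicator (A \<inter> {a<..<b}) x * h x \<partial>?M)"
      by (rule integral_restrict_space[symmetric]) auto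
    finally show ?thesis .
  qed
  have "AE x in lborel. h' x = 0"
  proof (rule AE_zero_of_interval_integrals)
    have "integrable lebesgue h'"
      using integrable_cong_AE[OF borel_measurable_integrable[OF il] h'm ae] il by blast
    then show "integrable lborel h'" using integrable_completion[OF h'(1)] by simp
    have ab: "{a<..<b} = {} \<or> a < b" by auto
    show "integral\<^sup>L lborel h' = 0"
      using int[of UNIV] at[of b] ab by auto
    show "(\<integral>x. indicator {..t} x * h' x \<partial>lborel) = 0" for t
    proof -
      consider "t \<le> a" | "b \<le> t" "a < b" | "a < t" "t < b" | "b \<le> a" by linarith
      then show ?thesis
      proof cases
        case 1
        then have "{..t} \<inter> {a<..<b} = {}" by auto
        then show ?thesis using int[of "{..t}"] by simp
      next
        case 2
        then have "{..t} \<inter> {a<..<b} = {a<..<b}" by auto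
        then show ?thesis using int[of "{..t}"] at[of b] 2 by simp
      next
        case 3
        have "(\<integral>x. indicator ({..t} \<inter> {a<..<b}) x * h x \<partial>?M)
            = (\<integral>x. indicator {a<..<t} x * h x \<partial>?M)"
        proof (rule integral_cong_AE)
          have "AE x in lebesgue. x \<noteq> t"
            using AE_completion[OF AE_lborel_singleton] .
          then have "AE x in ?M. x \<noteq> t"
            by (subst AE_restrict_space_iff) auto
          then show "AE x in ?M. indicator ({..t} \<inter> {a<..<b}) x * h x = indicator {a<..<t} x * h x"
            by eventually_elim (use 3 in \<open>auto simp: indicator_def\<close>)
          show "(\<lambda>x. indicator ({..t} \<inter> {a<..<b}) x * h x) \<in> borel_measurable ?M"
            "(\<lambda>x. indicator {a<..<t} x * h x) \<in> borel_measurable ?M"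
            using ih by (intro borel_measurable_times borel_measurable_indicator_lebesgue_on; simp)+
        qed
        then show ?thesis using int[of "{..t}"] at[of t] 3 by simp
      next
        case 4
        then show ?thesis using int[of "{..t}"] by simp
      qed
    qed
  qed
  then have "AE x in lborel. indicator {a<..<b} x * h x = 0"
    using h'(2) by eventually_elim simp
  then have "AE x in lebesgue. indicator {a<..<b} x * h x = 0"
    by (rule AE_completion)
  then show ?thesis
    by (subst AE_restrict_space_iff) (auto simp: h_def elim!: eventually_mono)
qed


section \<open>The energy inequality for a single bump\<close>

text \<open>
  This is where the continuity of the penalty and the minimality of \<open>w\<close> are reconciled.  When
  \<open>w' = \<beta>\<close> is smooth, integration by parts turns the cross term \<open>2 \<beta> p\<close> into
  \<open>- 2 \<beta>' z\<close>, which a penalty \<open>2 \<bar>\<beta>'\<bar> \<bar>z\<bar>\<close> compensates.  The penalty has to be capped at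
  \<open>\<bar>z\<bar> = \<rho>\<close>, because the penalties of infinitely many bumps must add up to a continuous function;
  a share \<open>\<alpha> p\<^sup>2\<close> of the quadratic energy pays for the cap.  There are two cases.

  If the energy of \<open>p\<close> over \<open>[l, r]\<close> is at least \<open>4 c\<^sup>2 (r - l) / \<alpha>\<^sup>2\<close>, then Young's inequality
  already absorbs the cross term into \<open>\<alpha> p\<^sup>2\<close>.  If not, \<open>z\<close> oscillates by at most \<open>\<rho> / 2\<close> over
  \<open>[l, r]\<close>.  As \<open>\<beta>'\<close> has integral \<open>0\<close>, any constant \<open>m\<close> may be subtracted from \<open>z\<close> after the
  integration by parts: \<open>m = 0\<close> works if \<open>\<bar>z\<bar> \<le> \<rho>\<close> throughout, and otherwise a value of \<open>z\<close> of
  modulus above \<open>\<rho>\<close> works, since then \<open>\<bar>z\<bar> \<ge> \<rho> / 2\<close> everywhere on \<open>[l, r]\<close>.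
\<close>

lemma single_bump_inequality:
  fixes a b :: real
  defines "M \<equiv> lebesgue_on {a<..<b}"
  assumes wd: "has_weak_deriv a b z p" and z: "continuous_on {a..b} z"
    and p2: "integrable M (\<lambda>x. (p x)\<^sup>2)"
    and \<beta>: "\<And>t. (\<beta> has_real_derivative \<beta>' t) (at t)" "continuous_on UNIV \<beta>'"
    and lr: "a < l" "l < r" "r < b"
    and supp: "\<And>t. t \<notin> {l..r} \<Longrightarrow> \<beta> t = 0" and bd: "\<And>t. \<bar>\<beta> t\<bar> \<le> c" and \<alpha>: "0 < \<alpha>"
  defines "\<rho> \<equiv> 4 * c * (r - l) / \<alpha>"
  shows "integrable M (\<lambda>x. 2 * \<bar>\<beta>' x\<bar> * min \<bar>z x\<bar> \<rho>)" (is "integrable M ?\<phi>")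
    and "integrable M (\<lambda>x. \<beta> x * p x)"
    and "0 \<le> (\<integral>x. 2 * \<bar>\<beta>' x\<bar> * min \<bar>z x\<bar> \<rho> + 2 * (\<beta> x * p x) + \<alpha> * (p x)\<^sup>2 \<partial>M)"
proof -
  have c: "0 \<le> c" using bd[of 0] by linarith
  have \<rho>: "0 \<le> \<rho>" using c lr \<alpha> by (simp add: \<rho>_def)
  have tf: "test_function a b \<beta>"
    using test_functionI[OF \<beta> lr(1,3) supp] .
  have supp': "\<beta>' t = 0" if "t \<notin> {l..r}" for t
  proof -
    have "((\<lambda>t. 0) has_real_derivative \<beta>' t) (at t)"
      by (rule has_field_derivative_transform_within_open[OF \<beta>(1), of "- {l..r}"])
        (use that supp in auto)
    then show ?thesis using DERIV_unique DERIV_const by blast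
  qed
  have "compact (\<beta>' ` {l..r})"
    using \<beta>(2) by (intro compact_continuous_image) (auto intro: continuous_on_subset)
  then obtain C where "\<forall>y\<in>\<beta>' ` {l..r}. norm y \<le> C"
    using compact_imp_bounded bounded_iff by metis
  then have "\<bar>\<beta>' t\<bar> \<le> max C 0" for t
    using supp'[of t] by (cases "t \<in> {l..r}") (auto simp: max.coboundedI1)
  then obtain C' where C': "\<And>t. \<bar>\<beta>' t\<bar> \<le> C'" by blast
  have c\<beta>: "continuous_on UNIV \<beta>"
    using \<beta>(1) by (auto intro!: DERIV_isCont continuous_at_imp_continuous_on)
  have m\<beta>: "\<beta> \<in> borel_measurable M" "\<beta>' \<in> borel_measurable M"
    unfolding M_def using c\<beta> \<beta>(2)
    by (intro borel_measurable_lebesgue_on_borel borel_measurable_continuous_onI; simp)+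
  have iz: "integrable M z" and ip: "integrable M p"
    using has_weak_derivD[OF wd] by (simp_all add: M_def)
  note [measurable] = m\<beta> iz[THEN borel_measurable_integrable] ip[THEN borel_measurable_integrable]
  have m\<phi>: "\<bar>?\<phi> x\<bar> \<le> 2 * C' * \<rho>" for x
  proof -
    have "\<bar>?\<phi> x\<bar> = 2 * (\<bar>\<beta>' x\<bar> * min \<bar>z x\<bar> \<rho>)"
      using \<rho> by (simp add: abs_mult)
    also have "\<dots> \<le> 2 * (C' * \<rho>)"
      using C'[of x] \<rho> by (intro mult_left_mono mult_mono) auto
    finally show ?thesis by simp
  qed
  have "?\<phi> \<in> borel_measurable M" by measurable
  then show i\<phi>: "integrable M ?\<phi>"
    unfolding M_def using m\<phi> by (intro integrable_bounded_lebesgue_on)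
  have "integrable M (\<lambda>x. p x * \<beta> x)"
    by (rule integrable_mult_bounded[OF ip m\<beta>(1) bd])
  then show i\<beta>p: "integrable M (\<lambda>x. \<beta> x * p x)"
    by (simp add: mult.commute)
  have iz\<beta>: "integrable M (\<lambda>x. z x * \<beta>' x)"
    by (rule integrable_mult_bounded[OF iz m\<beta>(2) C'])
  have i\<beta>': "integrable M \<beta>'"
    unfolding M_def by (rule integrable_bounded_lebesgue_on[OF m\<beta>(2)[unfolded M_def] C'])
  have i\<beta>'0: "(\<integral>x. \<beta>' x \<partial>M) = 0"
  proof -
    have "(\<integral>x. \<beta>' x \<partial>M) = (\<integral>x. indicator {a<..b} x * \<beta>' x \<partial>M)"
      unfolding M_def by (rule Bochner_Integration.integral_cong) auto
    also have "\<dots> = \<beta> b - \<beta> a"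
      unfolding M_def by (rule integral_FTC_lebesgue_on[OF _ _ _ \<beta>]) (use lr in auto)
    finally show ?thesis using supp lr by simp
  qed
  let ?I = "indicator {l..r} :: real \<Rightarrow> real"
  have mI: "?I \<in> borel_measurable M"
    unfolding M_def by (rule borel_measurable_indicator_lebesgue_on) simp
  have iI: "integrable M ?I" and II: "(\<integral>x. ?I x \<partial>M) = r - l"
    unfolding M_def by (rule integral_indicator_lebesgue_on[OF lr])+
  have ipI: "integrable M (\<lambda>x. ?I x * (p x)\<^sup>2)"
    using integrable_mult_bounded[OF p2 mI, of 1] by (auto simp: indicator_def mult.commute)
  define J where "J = (\<integral>x. ?I x * (p x)\<^sup>2 \<partial>M)"
  show "0 \<le> (\<integral>x. ?\<phi> x + 2 * (\<beta> x * p x) + \<alpha> * (p x)\<^sup>2 \<partial>M)"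
  proof (cases "4 * c\<^sup>2 * (r - l) \<le> \<alpha>\<^sup>2 * J")
    case True
    have "0 \<le> \<alpha> / 2 * J - 2 * c\<^sup>2 / \<alpha> * (r - l)"
      using True \<alpha> by (simp add: field_simps power2_eq_square)
    also have "\<dots> = (\<integral>x. \<alpha> / 2 * (?I x * (p x)\<^sup>2) - 2 * c\<^sup>2 / \<alpha> * ?I x \<partial>M)"
      using iI ipI II by (simp add: J_def)
    also have "\<dots> \<le> (\<integral>x. ?\<phi> x + 2 * (\<beta> x * p x) + \<alpha> * (p x)\<^sup>2 \<partial>M)"
    proof (rule integral_mono)
      show "integrable M (\<lambda>x. \<alpha> / 2 * (?I x * (p x)\<^sup>2) - 2 * c\<^sup>2 / \<alpha> * ?I x)"
        using iI ipI by auto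
      show "integrable M (\<lambda>x. ?\<phi> x + 2 * (\<beta> x * p x) + \<alpha> * (p x)\<^sup>2)"
        using i\<phi> i\<beta>p p2 by auto
      fix x
      have \<phi>0: "0 \<le> ?\<phi> x" using \<rho> by simp
      show "\<alpha> / 2 * (?I x * (p x)\<^sup>2) - 2 * c\<^sup>2 / \<alpha> * ?I x \<le> ?\<phi> x + 2 * (\<beta> x * p x) + \<alpha> * (p x)\<^sup>2"
      proof (cases "x \<in> {l..r}")
        case True
        \<comment> \<open>Young's inequality, leaving half of \<open>\<alpha> p\<^sup>2\<close> to be bounded below by the energy \<open>J\<close>.\<close>
        have "0 \<le> (2 * \<beta> x + \<alpha> * p x)\<^sup>2 / (2 * \<alpha>)" using \<alpha> by simp
        also have "\<dots> = 2 * (\<beta> x)\<^sup>2 / \<alpha> + 2 * (\<beta> x * p x) + \<alpha> / 2 * (p x)\<^sup>2"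
          using \<alpha> by (simp add: field_simps power2_eq_square)
        finally have "0 \<le> 2 * (\<beta> x)\<^sup>2 / \<alpha> + 2 * (\<beta> x * p x) + \<alpha> / 2 * (p x)\<^sup>2" .
        moreover have "2 * (\<beta> x)\<^sup>2 / \<alpha> \<le> 2 * c\<^sup>2 / \<alpha>"
          using bd[of x] \<alpha> c by (intro divide_right_mono mult_left_mono) (auto simp: abs_le_square_iff[symmetric])
        ultimately show ?thesis using True \<phi>0 by (auto simp: field_simps)
      next
        case False
        then have "?I x = 0" "\<beta> x = 0" using supp[of x] by simp_all
        then show ?thesis using \<phi>0 \<alpha> by simp
      qed
    qed
    finally show ?thesis .
  next
    case False
    then have c0: "0 < c" using c \<alpha> by (cases "c = 0") (auto simp: J_def intro!: Bochner_Integration.integral_nonneg)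
    have osc: "\<bar>z t - z s\<bar> \<le> \<rho> / 2" if st: "l \<le> s" "s \<le> t" "t \<le> r" for s t
    proof -
      have "z t - z s = (\<integral>x. indicator {s<..t} x * p x \<partial>M)"
        unfolding M_def by (rule has_weak_deriv_FTC[OF wd])
          (use lr st z in \<open>auto intro: continuous_on_subset\<close>)
      also have "\<bar>\<dots>\<bar> \<le> (\<integral>x. \<bar>indicator {s<..t} x * p x\<bar> \<partial>M)"
        by (rule integral_abs_bound)
      also have "\<dots> \<le> (\<integral>x. \<alpha> / (4 * c) * (?I x * (p x)\<^sup>2) + c / \<alpha> * ?I x \<partial>M)"
      proof (rule integral_mono')
        show "integrable M (\<lambda>x. \<alpha> / (4 * c) * (?I x * (p x)\<^sup>2) + c / \<alpha> * ?I x)"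
          using iI ipI by auto
        fix x
        \<comment> \<open>Young's inequality with weights chosen so that, for small \<open>J\<close>, both terms
          integrate to at most \<open>\<rho> / 4\<close>.\<close>
        have "0 \<le> (\<alpha> * \<bar>p x\<bar> - 2 * c)\<^sup>2 / (4 * c * \<alpha>)" using \<alpha> c by simp
        also have "\<dots> = \<alpha> / (4 * c) * (p x)\<^sup>2 + c / \<alpha> - \<bar>p x\<bar>"
          using \<alpha> c0 by (simp add: field_simps power2_eq_square)
        finally have "\<bar>p x\<bar> \<le> \<alpha> / (4 * c) * (p x)\<^sup>2 + c / \<alpha>" by simp
        then show "\<bar>indicator {s<..t} x * p x\<bar> \<le> \<alpha> / (4 * c) * (?I x * (p x)\<^sup>2) + c / \<alpha> * ?I x"
          using st \<alpha> c0 by (auto simp: indicator_def)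
      qed (use \<alpha> c in auto)
      also have "\<dots> = \<alpha> / (4 * c) * J + c / \<alpha> * (r - l)"
        using iI ipI II by (simp add: J_def)
      also have "\<dots> \<le> c * (r - l) / \<alpha> + c / \<alpha> * (r - l)"
      proof -
        have "\<alpha>\<^sup>2 * J / (4 * c * \<alpha>) \<le> 4 * c\<^sup>2 * (r - l) / (4 * c * \<alpha>)"
          using False \<alpha> c0 by (intro divide_right_mono) auto
        then show ?thesis using \<alpha> c0 by (simp add: power2_eq_square)
      qed
      also have "\<dots> = \<rho> / 2" by (simp add: \<rho>_def)
      finally show ?thesis .
    qed
    have osc': "\<bar>z t - z s\<bar> \<le> \<rho> / 2" if "s \<in> {l..r}" "t \<in> {l..r}" for s t
      using osc[of s t] osc[of t s] that by (cases "s \<le> t") (auto simp: abs_minus_commute)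
    have "\<exists>m. \<forall>x\<in>{l..r}. \<bar>z x - m\<bar> \<le> min \<bar>z x\<bar> \<rho>"
    proof (cases "\<forall>x\<in>{l..r}. \<bar>z x\<bar> \<le> \<rho>")
      case True
      then show ?thesis by (intro exI[of _ 0]) auto
    next
      case False
      then obtain x0 where x0: "x0 \<in> {l..r}" "\<rho> < \<bar>z x0\<bar>" by auto
      have "\<bar>z x - z x0\<bar> \<le> min \<bar>z x\<bar> \<rho>" if "x \<in> {l..r}" for x
        using osc'[OF x0(1) that] x0(2) \<rho> by (simp add: min_def) argo
      then show ?thesis by blast
    qed
    then obtain m where m: "\<And>x. x \<in> {l..r} \<Longrightarrow> \<bar>z x - m\<bar> \<le> min \<bar>z x\<bar> \<rho>" by blast
    have "(\<integral>x. \<beta> x * p x \<partial>M) = - (\<integral>x. z x * \<beta>' x \<partial>M)"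
      using has_weak_derivD_test[OF wd tf \<beta>(1)] by (simp add: M_def mult.commute)
    also have "\<dots> = - (\<integral>x. (z x - m) * \<beta>' x \<partial>M)"
      using iz\<beta> i\<beta>' i\<beta>'0 by (simp add: left_diff_distrib)
    finally have eq: "(\<integral>x. \<beta> x * p x \<partial>M) = - (\<integral>x. (z x - m) * \<beta>' x \<partial>M)" .
    have "2 * (\<integral>x. (z x - m) * \<beta>' x \<partial>M) = (\<integral>x. 2 * ((z x - m) * \<beta>' x) \<partial>M)"
      by simp
    also have "\<dots> \<le> (\<integral>x. ?\<phi> x \<partial>M)"
    proof (rule integral_mono)
      show "integrable M (\<lambda>x. 2 * ((z x - m) * \<beta>' x))"
        using iz\<beta> i\<beta>' by (simp add: left_diff_distrib)
      fix x
      show "2 * ((z x - m) * \<beta>' x) \<le> ?\<phi> x"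
      proof (cases "x \<in> {l..r}")
        case True
        have "(z x - m) * \<beta>' x \<le> \<bar>\<beta>' x\<bar> * \<bar>z x - m\<bar>"
          by (metis abs_ge_self abs_mult mult.commute)
        also have "\<dots> \<le> \<bar>\<beta>' x\<bar> * min \<bar>z x\<bar> \<rho>"
          using m[OF True] by (rule mult_left_mono) simp
        finally show ?thesis by simp
      qed (simp add: supp')
    qed (rule i\<phi>)
    finally have "0 \<le> (\<integral>x. ?\<phi> x \<partial>M) + 2 * (\<integral>x. \<beta> x * p x \<partial>M)"
      using eq by simp
    moreover have "0 \<le> \<alpha> * (\<integral>x. (p x)\<^sup>2 \<partial>M)"
      using \<alpha> by simp
    ultimately show ?thesis
      using i\<phi> i\<beta>p p2 by simp
  qed
qed

section \<open>Absolute continuity and Sobolev functions\<close>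

lemma AE_summable_of_summable_integrals:
  fixes f :: "nat \<Rightarrow> 'a \<Rightarrow> real"
  assumes f: "\<And>j. integrable M (f j)" "\<And>j x. 0 \<le> f j x" and s: "summable (\<lambda>j. \<integral>x. f j x \<partial>M)"
  shows "AE x in M. summable (\<lambda>j. f j x)"
proof -
  note [measurable] = f(1)[THEN borel_measurable_integrable]
  have "(\<integral>\<^sup>+x. (\<Sum>j. ennreal (f j x)) \<partial>M) = (\<Sum>j. \<integral>\<^sup>+x. ennreal (f j x) \<partial>M)"
    by (rule nn_integral_suminf) measurable
  also have "\<dots> = (\<Sum>j. ennreal (\<integral>x. f j x \<partial>M))"
    using f by (simp add: nn_integral_eq_integral)
  also have "\<dots> = ennreal (\<Sum>j. \<integral>x. f j x \<partial>M)"
    using f(2) s by (intro suminf_ennreal2 Bochner_Integration.integral_nonneg) auto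
  finally have "(\<integral>\<^sup>+x. (\<Sum>j. ennreal (f j x)) \<partial>M) \<noteq> \<infinity>"
    by simp
  then have "AE x in M. (\<Sum>j. ennreal (f j x)) \<noteq> \<infinity>"
    by (intro nn_integral_PInf_AE) measurable
  then show ?thesis
    by eventually_elim (use f(2) in \<open>auto intro: summable_suminf_not_top\<close>)
qed

lemma integral_abs_le_of_support:
  fixes f :: "real \<Rightarrow> real"
  assumes f: "f \<in> borel_measurable (lebesgue_on {a<..<b})" and bd: "\<And>x. \<bar>f x\<bar> \<le> C"
    and supp: "\<And>x. x \<notin> {l..r} \<Longrightarrow> f x = 0" and lr: "a < l" "l < r" "r < b"
  shows "integrable (lebesgue_on {a<..<b}) f"
    and "(\<integral>x. \<bar>f x\<bar> \<partial>lebesgue_on {a<..<b}) \<le> C * (r - l)"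
proof -
  let ?M = "lebesgue_on {a<..<b}" and ?I = "indicator {l..r} :: real \<Rightarrow> real"
  show i: "integrable ?M f"
    by (rule integrable_bounded_lebesgue_on[OF f bd])
  note I = integral_indicator_lebesgue_on[OF lr]
  have "(\<integral>x. \<bar>f x\<bar> \<partial>?M) \<le> (\<integral>x. C * ?I x \<partial>?M)"
  proof (rule integral_mono)
    show "\<bar>f x\<bar> \<le> C * ?I x" for x
      using bd[of x] supp[of x] by (cases "x \<in> {l..r}") simp_all
  qed (use i I(1) in auto)
  also have "\<dots> = C * (r - l)"
    using I(2) by simp
  finally show "(\<integral>x. \<bar>f x\<bar> \<partial>?M) \<le> C * (r - l)" .
qed

lemma integrable_of_square:
  fixes f :: "real \<Rightarrow> real"
  assumes "f \<in> borel_measurable (lebesgue_on {a<..<b})" "integrable (lebesgue_on {a<..<b}) (\<lambda>t. (f t)\<^sup>2)"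
  shows "integrable (lebesgue_on {a<..<b}) f"
proof (rule Bochner_Integration.integrable_bound)
  have "integrable (lebesgue_on {a<..<b}) (\<lambda>t. 1 :: real)"
    by (rule integrable_bounded_lebesgue_on[of _ _ _ 1]) auto
  then show "integrable (lebesgue_on {a<..<b}) (\<lambda>t. 1 + (f t)\<^sup>2)" using assms by auto
  have "norm (f t) \<le> norm (1 + (f t)\<^sup>2)" for t
  proof -
    have "0 \<le> (\<bar>f t\<bar> - 1)\<^sup>2" by simp
    then show ?thesis by (simp add: power2_eq_square algebra_simps abs_if split: if_splits)
  qed
  then show "AE t in lebesgue_on {a<..<b}. norm (f t) \<le> norm (1 + (f t)\<^sup>2)" by simp
qed fact

lemma abs_powr_2: "\<bar>x::real\<bar> powr 2 = x\<^sup>2"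
  by (cases "x = 0") (auto simp: powr_numeral)

lemma abs_continuous_on_imp_continuous_on:
  assumes "abs_continuous_on {a..b} f"
  shows "continuous_on {a..b} f"
  unfolding continuous_on_iff
proof (intro ballI allI impI)
  fix x e :: real assume x: "x \<in> {a..b}" and e: "0 < e"
  obtain d where d: "0 < d" "\<forall>D C. D division_of C \<and> C \<subseteq> {a..b} \<and> (\<Sum>k\<in>D. Sup k - Inf k) < d
      \<longrightarrow> (\<Sum>k\<in>D. \<bar>f (Sup k) - f (Inf k)\<bar>) < e"
    using assms[unfolded abs_continuous_on_def, rule_format, OF e] by (elim exE conjE)
  have *: "\<bar>f v - f u\<bar> < e" if "u \<in> {a..b}" "v \<in> {a..b}" "u \<le> v" "v - u < d" for u v
    using d(2)[rule_format, of "{{u..v}}" "{u..v}"] division_of_self[of u v] that by simp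
  have "dist (f y) (f x) < e" if "y \<in> {a..b}" "dist y x < d" for y
    using *[of x y] *[of y x] x that
    by (cases "x \<le> y") (auto simp: dist_real_def abs_minus_commute)
  then show "\<exists>d>0. \<forall>y\<in>{a..b}. dist y x < d \<longrightarrow> dist (f y) (f x) < e"
    using d(1) by blast
qed

text \<open>
  The total length of the intervals controls the total increment because, by Young's inequality,
  \<open>G \<le> h G\<^sup>2 / 2 + 1 / (2 h)\<close>: a small \<open>h\<close> makes the first part small whatever the intervals,
  and the second part is proportional to their total length.
\<close>

lemma abs_continuous_onI_square_integrable:
  fixes G :: "real \<Rightarrow> real"
  assumes G: "integrable (lebesgue_on {a<..<b}) (\<lambda>x. (G x)\<^sup>2)" "integrable (lebesgue_on {a<..<b}) G"
    and f: "\<And>s t. a \<le> s \<Longrightarrow> s \<le> t \<Longrightarrow> t \<le> b \<Longrightarrow>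
      \<bar>f t - f s\<bar> \<le> (\<integral>x. indicator {s<..t} x * G x \<partial>lebesgue_on {a<..<b})"
  shows "abs_continuous_on {a..b} f"
  unfolding abs_continuous_on_def
proof (intro allI impI)
  let ?M = "lebesgue_on {a<..<b}"
  fix e :: real assume e: "0 < e"
  define A where "A = (\<integral>x. (G x)\<^sup>2 \<partial>?M)"
  have A: "0 \<le> A" unfolding A_def by simp
  define h where "h = e / (A + 1)"
  have h: "0 < h" "h * A \<le> e"
    using e A by (auto simp: h_def field_simps)
  show "\<exists>\<delta>>0. \<forall>D C. D division_of C \<and> C \<subseteq> {a..b} \<and> (\<Sum>k\<in>D. Sup k - Inf k) < \<delta>
        \<longrightarrow> (\<Sum>k\<in>D. \<bar>f (Sup k) - f (Inf k)\<bar>) < e"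
  proof (intro exI[of _ "e * h"] conjI allI impI)
    show "0 < e * h" using e h by simp
    fix D :: "real set set" and C assume "D division_of C \<and> C \<subseteq> {a..b} \<and> (\<Sum>k\<in>D. Sup k - Inf k) < e * h"
    then have D: "D division_of C" "C \<subseteq> {a..b}" "(\<Sum>k\<in>D. Sup k - Inf k) < e * h" by auto
    have k: "\<exists>u v. k = {u..v} \<and> u \<le> v \<and> a \<le> u \<and> v \<le> b" if "k \<in> D" for k
    proof -
      obtain u v where "k = cbox u v" "k \<noteq> {}" "k \<subseteq> {a..b}"
        using division_ofD[OF D(1)] D(2) \<open>k \<in> D\<close> by (metis order_trans)
      then show ?thesis by auto
    qed
    then have k': "Inf k \<le> Sup k" "a \<le> Inf k" "Sup k \<le> b" if "k \<in> D" for k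
      using that by fastforce+
    let ?I = "\<lambda>k. indicator {Inf k<..Sup k} :: real \<Rightarrow> real"
    \<comment> \<open>Half-open intervals with disjoint interiors are disjoint.\<close>
    have le1: "(\<Sum>k\<in>D. ?I k x) \<le> 1" for x
    proof (cases "\<exists>k\<in>D. x \<in> {Inf k<..Sup k}")
      case True
      then obtain k where kD: "k \<in> D" "x \<in> {Inf k<..Sup k}" by blast
      have "?I k' x = 0" if "k' \<in> D - {k}" for k'
      proof (rule ccontr)
        assume "?I k' x \<noteq> 0"
        then have x': "x \<in> {Inf k'<..Sup k'}" by (auto simp: indicator_def split: if_splits)
        obtain u v u' v' where uv: "k = {u..v}" "k' = {u'..v'}" "u \<le> v" "u' \<le> v'"
          using k[OF kD(1)] k[of k'] \<open>k' \<in> D - {k}\<close> by blast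
        obtain y where "max u u' < y" "y < x"
          using dense[of "max u u'" x] kD(2) x' uv by auto
        then have "y \<in> interior k \<inter> interior k'"
          using kD(2) x' uv by auto
        then show False
          using division_ofD(5)[OF D(1) kD(1), of k'] \<open>k' \<in> D - {k}\<close> by auto
      qed
      then have "(\<Sum>k'\<in>D - {k}. ?I k' x) = 0" by (rule sum.neutral[OF ballI])
      then show ?thesis
        using kD division_ofD(1)[OF D(1)] by (simp add: sum.remove[of D k])
    next
      case False
      then have "(\<Sum>k\<in>D. ?I k x) = 0" by (intro sum.neutral) (auto simp: indicator_def)
      then show ?thesis by simp
    qed
    have mI: "?I k \<in> borel_measurable ?M" for k
      by (rule borel_measurable_indicator_lebesgue_on) simp
    have iI: "integrable ?M (?I k)" for k
      by (rule integrable_bounded_lebesgue_on[OF mI, where C=1]) (auto simp: indicator_def)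
    have iGI: "integrable ?M (\<lambda>x. ?I k x * G x)" for k
      using integrable_mult_bounded[OF G(2) mI[of k], where C=1] by (auto simp: indicator_def mult.commute)
    have II: "(\<integral>x. ?I k x \<partial>?M) \<le> Sup k - Inf k" if "k \<in> D" for k
    proof -
      have "(\<integral>x. ?I k x \<partial>?M) = (\<integral>x. indicator {a<..<b} x * ?I k x \<partial>lborel)"
        by (rule integral_lebesgue_on_borel) auto
      also have "\<dots> \<le> (\<integral>x. ?I k x \<partial>lborel)"
      proof (rule integral_mono')
        show "integrable lborel (?I k)" by (simp add: k'[OF that])
      qed (auto simp: indicator_def)
      also have "\<dots> = Sup k - Inf k" using k'[OF that] by simp
      finally show ?thesis .
    qed
    have "(\<Sum>k\<in>D. \<bar>f (Sup k) - f (Inf k)\<bar>) \<le> (\<Sum>k\<in>D. \<integral>x. ?I k x * G x \<partial>?M)"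
      using f k' by (intro sum_mono) auto
    also have "\<dots> = (\<integral>x. (\<Sum>k\<in>D. ?I k x * G x) \<partial>?M)"
      using iGI by (simp add: Bochner_Integration.integral_sum)
    also have "\<dots> \<le> (\<integral>x. h / 2 * (G x)\<^sup>2 + 1 / (2 * h) * (\<Sum>k\<in>D. ?I k x) \<partial>?M)"
    proof (rule integral_mono)
      show "integrable ?M (\<lambda>x. \<Sum>k\<in>D. ?I k x * G x)" using iGI by auto
      show "integrable ?M (\<lambda>x. h / 2 * (G x)\<^sup>2 + 1 / (2 * h) * (\<Sum>k\<in>D. ?I k x))"
        using G iI by auto
      fix x
      define S where "S = (\<Sum>k\<in>D. ?I k x)"
      have S: "0 \<le> S" "S \<le> 1" using le1 by (auto simp: S_def intro!: sum_nonneg)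
      have "0 \<le> (h * G x - 1)\<^sup>2 / (2 * h)" using h by simp
      also have "\<dots> = h / 2 * (G x)\<^sup>2 + 1 / (2 * h) - G x"
        using h by (simp add: field_simps power2_eq_square)
      finally have "S * G x \<le> S * (h / 2 * (G x)\<^sup>2 + 1 / (2 * h))"
        using S by (intro mult_left_mono) auto
      also have "\<dots> \<le> h / 2 * (G x)\<^sup>2 + 1 / (2 * h) * S"
      proof -
        have "S * (h / 2 * (G x)\<^sup>2) \<le> 1 * (h / 2 * (G x)\<^sup>2)"
          using S h by (intro mult_right_mono) auto
        then show ?thesis by (simp add: algebra_simps)
      qed
      finally show "(\<Sum>k\<in>D. ?I k x * G x) \<le> h / 2 * (G x)\<^sup>2 + 1 / (2 * h) * (\<Sum>k\<in>D. ?I k x)"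
        by (simp add: S_def sum_distrib_right)
    qed
    also have "\<dots> = h / 2 * A + 1 / (2 * h) * (\<Sum>k\<in>D. \<integral>x. ?I k x \<partial>?M)"
      using G iI by (simp add: A_def Bochner_Integration.integral_sum)
    also have "\<dots> \<le> h / 2 * A + 1 / (2 * h) * (\<Sum>k\<in>D. Sup k - Inf k)"
      using II h by (intro add_left_mono mult_left_mono sum_mono) auto
    also have "\<dots> < h / 2 * A + 1 / (2 * h) * (e * h)"
      using D(3) h by (intro add_strict_left_mono mult_strict_left_mono) auto
    also have "\<dots> \<le> e"
      using h by simp
    finally show "(\<Sum>k\<in>D. \<bar>f (Sup k) - f (Inf k)\<bar>) < e" .
  qed
qed

lemma sobolev_continuous_on: "u \<in> sobolev p a b \<Longrightarrow> continuous_on {a..b} u"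
  by (auto simp: sobolev_def intro: abs_continuous_on_imp_continuous_on)

lemma sobolev_has_weak_deriv:
  assumes "u \<in> sobolev p a b"
  shows "has_weak_deriv a b u (weak_deriv a b u)"
proof -
  obtain v where "has_weak_deriv a b u v"
    using assms by (auto simp: sobolev_def)
  then show ?thesis
    unfolding weak_deriv_def by (rule someI[of "has_weak_deriv a b u"])
qed

lemma has_weak_deriv_smooth:
  assumes v: "\<And>t. (v has_real_derivative v' t) (at t)" "continuous_on UNIV v'"
  shows "has_weak_deriv a b v v'"
  unfolding has_weak_deriv_def
proof (intro conjI allI impI)
  let ?M = "lebesgue_on {a<..<b}"
  have cv: "continuous_on UNIV v"
    using v(1) by (auto intro!: DERIV_isCont continuous_at_imp_continuous_on)
  then show "integrable ?M v" "integrable ?M v'"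
    using v(2) by (auto intro: integrable_continuous_lebesgue_on)
  fix \<psi> assume \<psi>: "test_function a b \<psi>"
  note d = test_functionD(1)[OF \<psi>] and c = test_functionD(2,3)[OF \<psi>]
  have i: "integrable ?M (\<lambda>t. v t * deriv \<psi> t)" "integrable ?M (\<lambda>t. v' t * \<psi> t)"
    using cv v(2) c by (auto intro!: integrable_continuous_lebesgue_on continuous_intros)
  have "(\<integral>t. v t * deriv \<psi> t + v' t * \<psi> t \<partial>?M) = 0"
  proof (cases "a < b")
    case True
    have "\<psi> a = 0" "\<psi> b = 0" using \<psi> unfolding test_function_def by auto
    have "(\<integral>t. v t * deriv \<psi> t + v' t * \<psi> t \<partial>?M)
        = (\<integral>t. indicator {a<..b} t * (v t * deriv \<psi> t + v' t * \<psi> t) \<partial>?M)"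
      by (rule Bochner_Integration.integral_cong) auto
    also have "\<dots> = (\<lambda>t. v t * \<psi> t) b - (\<lambda>t. v t * \<psi> t) a"
    proof (rule integral_FTC_lebesgue_on)
      show "((\<lambda>t. v t * \<psi> t) has_real_derivative v t * deriv \<psi> t + v' t * \<psi> t) (at t)" for t
        using DERIV_mult[OF v(1) d, of t] by (simp add: algebra_simps)
      show "continuous_on UNIV (\<lambda>t. v t * deriv \<psi> t + v' t * \<psi> t)"
        using cv v(2) c by (intro continuous_intros)
    qed (use True in auto)
    finally show ?thesis using \<open>\<psi> a = 0\<close> \<open>\<psi> b = 0\<close> by simp
  qed simp
  then show "(\<integral>t. v t * deriv \<psi> t \<partial>?M) = - (\<integral>t. v' t * \<psi> t \<partial>?M)"
    using i by simp
qed

section \<open>Superposition of bumps\<close>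

text \<open>
  Infinitely many bumps \<open>\<beta> j\<close> with primitives \<open>B j\<close> are added up.  The weights \<open>\<alpha> j\<close> distribute
  the quadratic energy among the bumps, so their sum may not exceed \<open>1\<close>.  The last assumption makes
  the derivative of the sum square integrable, by the Cauchy-Schwarz inequality
  \<open>(\<Sum>j. \<bar>\<beta> j\<bar>)\<^sup>2 \<le> (\<Sum>j. \<alpha> j) (\<Sum>j. (\<beta> j)\<^sup>2 / \<alpha> j)\<close>; at individual points the series of the
  \<open>\<beta> j\<close> may well diverge.
\<close>

locale bump_superposition =
  fixes T :: real and B \<beta> \<beta>' :: "nat \<Rightarrow> real \<Rightarrow> real" and \<alpha> c l r :: "nat \<Rightarrow> real"
  assumes T: "0 < T"
    and DERIV_B: "\<And>j t. (B j has_real_derivative \<beta> j t) (at t)"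
    and DERIV_\<beta>: "\<And>j t. (\<beta> j has_real_derivative \<beta>' j t) (at t)"
    and cont_\<beta>': "\<And>j. continuous_on UNIV (\<beta>' j)"
    and lr: "\<And>j. - T < l j" "\<And>j. l j < r j" "\<And>j. r j < T"
    and supp: "\<And>j t. t \<notin> {l j..r j} \<Longrightarrow> \<beta> j t = 0"
    and bd: "\<And>j t. \<bar>\<beta> j t\<bar> \<le> c j"
    and B0: "\<And>j. B j (- T) = 0"
    and \<alpha>: "\<And>j. 0 < \<alpha> j" "summable \<alpha>" "(\<Sum>j. \<alpha> j) \<le> 1"
    and sum1: "summable (\<lambda>j. c j * (r j - l j))"
    and sum2: "summable (\<lambda>j. (c j)\<^sup>2 * (r j - l j) / \<alpha> j)"
begin

abbreviation "M \<equiv> lebesgue_on {- T<..<T}"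

definition w :: "real \<Rightarrow> real" where "w t = (\<Sum>j. B j t)"

definition g :: "real \<Rightarrow> real" where "g t = (\<Sum>j. \<beta> j t)"

text \<open>
  The majorant of all partial sums of \<open>g\<close>, for dominated convergence.
\<close>

definition G :: "real \<Rightarrow> real" where "G t = (\<Sum>j. \<bar>\<beta> j t\<bar>)"

lemma c_nonneg: "0 \<le> c j"
  using bd[of j 0] by linarith

lemma cont_\<beta>: "continuous_on UNIV (\<beta> j)"
  using DERIV_\<beta> by (auto intro!: DERIV_isCont continuous_at_imp_continuous_on)

lemma measurable_\<beta> [measurable]: "\<beta> j \<in> borel_measurable M"
  by (intro borel_measurable_lebesgue_on_borel borel_measurable_continuous_onI cont_\<beta>)

lemma integrable_\<beta>: "integrable M (\<beta> j)" and integral_\<beta>: "(\<integral>t. \<bar>\<beta> j t\<bar> \<partial>M) \<le> c j * (r j - l j)"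
  by (rule integral_abs_le_of_support[OF measurable_\<beta> bd supp lr]; assumption)+

lemma integrable_\<beta>_square: "integrable M (\<lambda>t. (\<beta> j t)\<^sup>2 / \<alpha> j)"
  and integral_\<beta>_square: "(\<integral>t. (\<beta> j t)\<^sup>2 / \<alpha> j \<partial>M) \<le> (c j)\<^sup>2 * (r j - l j) / \<alpha> j"
proof -
  have "\<bar>(\<beta> j t)\<^sup>2 / \<alpha> j\<bar> \<le> (c j)\<^sup>2 / \<alpha> j" for t
    using power_mono[OF bd[of j t], of 2] \<alpha>(1)[of j] by (simp add: divide_right_mono)
  note * = integral_abs_le_of_support[OF _ this _ lr, of "\<lambda>t. t"]
  show "integrable M (\<lambda>t. (\<beta> j t)\<^sup>2 / \<alpha> j)" "(\<integral>t. (\<beta> j t)\<^sup>2 / \<alpha> j \<partial>M) \<le> (c j)\<^sup>2 * (r j - l j) / \<alpha> j"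
    using *[of j] supp[of _ j] \<alpha>(1)[of j] by auto
qed

lemma square_sum_le: "(\<Sum>j<N. \<bar>\<beta> j t\<bar>)\<^sup>2 \<le> (\<Sum>j<N. (\<beta> j t)\<^sup>2 / \<alpha> j)"
proof -
  have "(\<Sum>j<N. \<bar>\<beta> j t\<bar>)\<^sup>2 = (\<Sum>j<N. sqrt (\<alpha> j) * (\<bar>\<beta> j t\<bar> / sqrt (\<alpha> j)))\<^sup>2"
    using \<alpha>(1) by (intro arg_cong[where f="\<lambda>x. x\<^sup>2"] sum.cong) (auto simp: less_imp_neq[symmetric])
  also have "\<dots> \<le> (\<Sum>j<N. (sqrt (\<alpha> j))\<^sup>2) * (\<Sum>j<N. (\<bar>\<beta> j t\<bar> / sqrt (\<alpha> j))\<^sup>2)"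
    by (rule Cauchy_Schwarz_ineq_sum)
  also have "\<dots> = (\<Sum>j<N. \<alpha> j) * (\<Sum>j<N. (\<beta> j t)\<^sup>2 / \<alpha> j)"
    using \<alpha>(1) by (simp add: power_divide less_imp_le)
  also have "\<dots> \<le> 1 * (\<Sum>j<N. (\<beta> j t)\<^sup>2 / \<alpha> j)"
    using sum_le_suminf[OF \<alpha>(2), of "{..<N}"] \<alpha>(1,3)
    by (intro mult_right_mono sum_nonneg divide_nonneg_nonneg) (auto simp: less_imp_le intro: order_trans)
  finally show ?thesis by simp
qed

lemma AE_summable_\<beta>_square: "AE t in M. summable (\<lambda>j. (\<beta> j t)\<^sup>2 / \<alpha> j)"
proof (rule AE_summable_of_summable_integrals[OF integrable_\<beta>_square])
  show "summable (\<lambda>j. \<integral>t. (\<beta> j t)\<^sup>2 / \<alpha> j \<partial>M)"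
    using integral_\<beta>_square \<alpha>(1)
    by (intro summable_comparison_test'[OF sum2, of 0]) (auto simp: less_imp_le)
qed (use \<alpha>(1) in \<open>auto simp: less_imp_le\<close>)

lemma AE_G: "AE t in M. summable (\<lambda>j. \<bar>\<beta> j t\<bar>) \<and> (G t)\<^sup>2 \<le> (\<Sum>j. (\<beta> j t)\<^sup>2 / \<alpha> j)"
  using AE_summable_\<beta>_square
proof eventually_elim
  case (elim t)
  define H where "H = (\<Sum>j. (\<beta> j t)\<^sup>2 / \<alpha> j)"
  have H: "(\<Sum>j<N. (\<beta> j t)\<^sup>2 / \<alpha> j) \<le> H" for N
    unfolding H_def using \<alpha>(1) by (intro sum_le_suminf elim) (auto simp: less_imp_le)
  have "(\<Sum>j<N. \<bar>\<beta> j t\<bar>) \<le> sqrt H" for N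
    using square_sum_le[where N=N and t=t] H[of N] by (intro real_le_rsqrt) linarith
  then have "summable (\<lambda>j. \<bar>\<beta> j t\<bar>)" "G t \<le> sqrt H"
    by (auto simp: G_def intro!: summableI_nonneg_bounded[of _ "sqrt H"] suminf_le_const)
  moreover have "0 \<le> G t"
    unfolding G_def using calculation(1) by (intro suminf_nonneg) auto
  moreover have "0 \<le> H" using H[of 0] by simp
  ultimately show ?case
    using power_mono[of "G t" "sqrt H" 2] by (simp add: H_def)
qed

lemma measurable_g [measurable]: "g \<in> borel_measurable M" and measurable_G [measurable]: "G \<in> borel_measurable M"
  unfolding g_def[abs_def] G_def[abs_def] by measurable

lemma integrable_G_square: "integrable M (\<lambda>t. (G t)\<^sup>2)"
proof (rule Bochner_Integration.integrable_bound)
  show "integrable M (\<lambda>t. \<Sum>j. (\<beta> j t)\<^sup>2 / \<alpha> j)"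
  proof (rule integrable_suminf[OF integrable_\<beta>_square])
    show "AE t in M. summable (\<lambda>j. norm ((\<beta> j t)\<^sup>2 / \<alpha> j))"
      using AE_summable_\<beta>_square \<alpha>(1) by (simp add: less_imp_le)
    show "summable (\<lambda>j. \<integral>t. norm ((\<beta> j t)\<^sup>2 / \<alpha> j) \<partial>M)"
      using integral_\<beta>_square \<alpha>(1)
      by (intro summable_comparison_test'[OF sum2, of 0]) (auto simp: less_imp_le)
  qed
  show "AE t in M. norm ((G t)\<^sup>2) \<le> norm (\<Sum>j. (\<beta> j t)\<^sup>2 / \<alpha> j)"
    using AE_G by eventually_elim auto
qed measurable

lemma integrable_G: "integrable M G"
  by (rule integrable_of_square[OF measurable_G integrable_G_square])

lemma AE_g_le_G: "AE t in M. \<bar>g t\<bar> \<le> G t \<and> (\<forall>N. \<bar>\<Sum>j<N. \<beta> j t\<bar> \<le> G t) \<and> (\<lambda>N. \<Sum>j<N. \<beta> j t) \<longlonglongrightarrow> g t"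
  using AE_G
proof eventually_elim
  case (elim t)
  then have s: "summable (\<lambda>j. \<bar>\<beta> j t\<bar>)" by simp
  have "\<bar>\<Sum>j<N. \<beta> j t\<bar> \<le> G t" for N
    unfolding G_def using sum_le_suminf[OF s, of "{..<N}"]
    by (intro order_trans[OF sum_abs]) simp
  then show ?case
    unfolding G_def g_def using s summable_rabs[OF s] summable_LIMSEQ[OF summable_rabs_cancel[OF s]] by auto
qed

lemma integrable_g_square: "integrable M (\<lambda>t. (g t)\<^sup>2)"
proof (rule Bochner_Integration.integrable_bound[OF integrable_G_square])
  show "AE t in M. norm ((g t)\<^sup>2) \<le> norm ((G t)\<^sup>2)"
    using AE_g_le_G by eventually_elim (auto simp: abs_le_square_iff[symmetric])
qed measurable

lemma integrable_g: "integrable M g"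
  by (rule integrable_of_square[OF measurable_g integrable_g_square])

lemma summable_integral_abs_\<beta>: "summable (\<lambda>j. \<integral>t. \<bar>\<beta> j t\<bar> \<partial>M)"
  using integral_\<beta> by (intro summable_comparison_test'[OF sum1, of 0]) auto

lemma integral_mult_\<beta>_sums:
  assumes h: "h \<in> borel_measurable M" "\<And>t. t \<in> {- T<..<T} \<Longrightarrow> \<bar>h t\<bar> \<le> C"
  shows "(\<lambda>j. \<integral>t. h t * \<beta> j t \<partial>M) sums (\<integral>t. h t * g t \<partial>M)"
proof -
  have int: "integrable M (\<lambda>t. h t * \<beta> j t)" for j
    using integrable_mult_bounded[OF integrable_\<beta>[of j] h(1), where C=C] h(2) by (simp add: mult.commute)
  have "(\<lambda>j. \<integral>t. h t * \<beta> j t \<partial>M) sums (\<integral>t. (\<Sum>j. h t * \<beta> j t) \<partial>M)"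
  proof (rule sums_integral[OF int])
    show "AE t in M. summable (\<lambda>j. norm (h t * \<beta> j t))"
      using AE_G by eventually_elim (auto simp: abs_mult intro!: summable_mult)
    have le: "(\<integral>t. norm (h t * \<beta> j t) \<partial>M) \<le> C * (\<integral>t. \<bar>\<beta> j t\<bar> \<partial>M)" for j
    proof -
      have "(\<integral>t. norm (h t * \<beta> j t) \<partial>M) \<le> (\<integral>t. C * \<bar>\<beta> j t\<bar> \<partial>M)"
      proof (rule integral_mono)
        show "integrable M (\<lambda>t. norm (h t * \<beta> j t))" "integrable M (\<lambda>t. C * \<bar>\<beta> j t\<bar>)"
          using int[of j] integrable_\<beta>[of j] by auto
        show "norm (h t * \<beta> j t) \<le> C * \<bar>\<beta> j t\<bar>" if "t \<in> space M" for t
          using h(2)[of t] that by (simp add: abs_mult mult_right_mono)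
      qed
      then show ?thesis by simp
    qed
    show "summable (\<lambda>j. \<integral>t. norm (h t * \<beta> j t) \<partial>M)"
      by (rule summable_comparison_test'[OF summable_mult[OF summable_integral_abs_\<beta>, of C], of 0])
        (use le in auto)
  qed
  moreover have "(\<integral>t. (\<Sum>j. h t * \<beta> j t) \<partial>M) = (\<integral>t. h t * g t \<partial>M)"
  proof (rule integral_cong_AE)
    show "AE t in M. (\<Sum>j. h t * \<beta> j t) = h t * g t"
      using AE_G
    proof eventually_elim
      case (elim t)
      then show ?case
        unfolding g_def using suminf_mult[OF summable_rabs_cancel, of "\<lambda>j. \<beta> j t" "h t"] by simp
    qed
    show "(\<lambda>t. \<Sum>j. h t * \<beta> j t) \<in> borel_measurable M"
      by (rule borel_measurable_suminf) (rule borel_measurable_times[OF h(1) measurable_\<beta>])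
    show "(\<lambda>t. h t * g t) \<in> borel_measurable M"
      by (rule borel_measurable_times[OF h(1) measurable_g])
  qed
  ultimately show ?thesis by simp
qed

lemma B_diff: "- T \<le> s \<Longrightarrow> s \<le> t \<Longrightarrow> t \<le> T \<Longrightarrow> B j t - B j s = (\<integral>x. indicator {s<..t} x * \<beta> j x \<partial>M)"
  using integral_FTC_lebesgue_on[OF _ _ _ DERIV_B cont_\<beta>, of "- T" s t T] by simp

lemma B_le:
  assumes "t \<in> {- T..T}"
  shows "\<bar>B j t\<bar> \<le> c j * (r j - l j)"
proof -
  have "\<bar>B j t\<bar> = \<bar>\<integral>x. indicator {- T<..t} x * \<beta> j x \<partial>M\<bar>"
    using B_diff[of "- T" t j] assms B0 by simp
  also have "\<dots> \<le> (\<integral>x. \<bar>indicator {- T<..t} x * \<beta> j x\<bar> \<partial>M)"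
    by (rule integral_abs_bound)
  also have "\<dots> \<le> (\<integral>x. \<bar>\<beta> j x\<bar> \<partial>M)"
    using integrable_\<beta>[of j] by (intro integral_mono') (auto simp: indicator_def)
  finally show ?thesis using integral_\<beta>[of j] by simp
qed

lemma summable_B: "t \<in> {- T..T} \<Longrightarrow> summable (\<lambda>j. B j t)"
  using B_le[of t] by (intro summable_comparison_test'[OF sum1, of 0]) auto

text \<open>
  Each \<open>B j\<close> is the integral of \<open>\<beta> j\<close>, and the series may be integrated term by term because
  the integrals of \<open>\<bar>\<beta> j\<bar>\<close> are summable.
\<close>

lemma w_diff:
  assumes "- T \<le> s" "s \<le> t" "t \<le> T"
  shows "w t - w s = (\<integral>x. indicator {s<..t} x * g x \<partial>M)"
proof -
  have "(\<lambda>j. \<integral>x. indicator {s<..t} x * \<beta> j x \<partial>M) sums (\<integral>x. indicator {s<..t} x * g x \<partial>M)"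
    by (rule integral_mult_\<beta>_sums[where C=1, OF borel_measurable_indicator_lebesgue_on]) (auto simp: indicator_def)
  moreover have "(\<lambda>j. B j t - B j s) sums (w t - w s)"
    unfolding w_def using assms by (intro sums_diff summable_sums summable_B) auto
  ultimately show ?thesis
    using assms by (simp add: B_diff sums_unique2)
qed

lemma abs_continuous_w: "abs_continuous_on {- T..T} w"
proof (rule abs_continuous_onI_square_integrable[OF integrable_G_square integrable_G])
  fix s t assume st: "- T \<le> s" "s \<le> t" "t \<le> T"
  have mI: "(indicator {s<..t} :: real \<Rightarrow> real) \<in> borel_measurable M"
    by (rule borel_measurable_indicator_lebesgue_on) simp
  have "\<bar>w t - w s\<bar> \<le> (\<integral>x. \<bar>indicator {s<..t} x * g x\<bar> \<partial>M)"
    unfolding w_diff[OF st] by (rule integral_abs_bound)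
  also have "\<dots> \<le> (\<integral>x. indicator {s<..t} x * G x \<partial>M)"
  proof (rule integral_mono_AE)
    show "integrable M (\<lambda>x. \<bar>indicator {s<..t} x * g x\<bar>)"
      using integrable_mult_bounded[OF integrable_g mI, where C=1] by (auto simp: mult.commute indicator_def)
    show "integrable M (\<lambda>x. indicator {s<..t} x * G x)"
      using integrable_mult_bounded[OF integrable_G mI, where C=1] by (auto simp: mult.commute indicator_def)
    show "AE x in M. \<bar>indicator {s<..t} x * g x\<bar> \<le> indicator {s<..t} x * G x"
      using AE_g_le_G by eventually_elim (auto simp: indicator_def)
  qed
  finally show "\<bar>w t - w s\<bar> \<le> (\<integral>x. indicator {s<..t} x * G x \<partial>M)" .
qed

lemma continuous_w: "continuous_on {- T..T} w"
  by (rule abs_continuous_on_imp_continuous_on[OF abs_continuous_w])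

lemma bounded_w: "t \<in> {- T..T} \<Longrightarrow> \<bar>w t\<bar> \<le> (\<Sum>j. c j * (r j - l j))"
  unfolding w_def using B_le[of t]
  by (intro order_trans[OF summable_rabs suminf_le] sum1 summable_comparison_test'[OF sum1, of 0]) auto

lemma measurable_w: "w \<in> borel_measurable M"
  using continuous_w by (intro continuous_imp_measurable_on_sets_lebesgue) (auto intro: continuous_on_subset)

text \<open>
  Each \<open>B j\<close> has the weak derivative \<open>\<beta> j\<close>, and both sides of the defining identity may be summed
  over \<open>j\<close> under the integral.
\<close>

lemma has_weak_deriv_w: "has_weak_deriv (- T) T w g"
  unfolding has_weak_deriv_def
proof (intro conjI allI impI)
  show "integrable M w" using bounded_w
    by (intro integrable_bounded_lebesgue_on[OF measurable_w, where C="\<Sum>j. c j * (r j - l j)"]) auto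
  show "integrable M g" by (rule integrable_g)
  fix \<psi> assume \<psi>: "test_function (- T) T \<psi>"
  note d = test_functionD(1)[OF \<psi>] and c = test_functionD(2,3)[OF \<psi>]
  obtain C where C: "\<And>t. t \<in> {- T<..<T} \<Longrightarrow> \<bar>\<psi> t\<bar> \<le> C"
    using bounded_on_interval_of_continuous[OF c(1)] by blast
  obtain C' where C': "\<And>t. t \<in> {- T<..<T} \<Longrightarrow> \<bar>deriv \<psi> t\<bar> \<le> C'"
    using bounded_on_interval_of_continuous[OF c(2)] by blast
  have m: "\<psi> \<in> borel_measurable M" "deriv \<psi> \<in> borel_measurable M"
    using c by (auto intro!: borel_measurable_lebesgue_on_borel borel_measurable_continuous_onI)
  have iB: "integrable M (B j)" for j
    using has_weak_derivD(1)[OF has_weak_deriv_smooth[OF DERIV_B cont_\<beta>]] .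
  have iB\<psi>: "integrable M (\<lambda>t. B j t * deriv \<psi> t)" for j
    using C' by (intro integrable_mult_bounded[OF iB m(2)]) auto
  have C'0: "0 \<le> C'" using C'[of 0] T by auto
  have le: "(\<integral>t. norm (B j t * deriv \<psi> t) \<partial>M) \<le> (2 * T * C') * (c j * (r j - l j))" for j
  proof -
    have ic: "integrable M (\<lambda>t. k)" for k :: real
      by (rule integrable_bounded_lebesgue_on[of _ _ _ "\<bar>k\<bar>"]) auto
    have "(\<integral>t. norm (B j t * deriv \<psi> t) \<partial>M) \<le> (\<integral>t. c j * (r j - l j) * C' \<partial>M)"
    proof (rule integral_mono[OF integrable_norm[OF iB\<psi>] ic])
      show "norm (B j t * deriv \<psi> t) \<le> c j * (r j - l j) * C'" if "t \<in> space M" for t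
        unfolding real_norm_def abs_mult using that B_le[of t j] C'[of t] c_nonneg[of j] lr(2)[of j]
        by (intro mult_mono) auto
    qed
    also have "\<dots> = (2 * T * C') * (c j * (r j - l j))"
    proof -
      have "measure M {- T<..<T} = 2 * T"
        using T by (subst measure_restrict_space) auto
      then show ?thesis by simp
    qed
    finally show ?thesis .
  qed
  have "(\<lambda>j. \<integral>t. B j t * deriv \<psi> t \<partial>M) sums (\<integral>t. (\<Sum>j. B j t * deriv \<psi> t) \<partial>M)"
  proof (rule sums_integral[OF iB\<psi>])
    have "summable (\<lambda>j. norm (B j t * deriv \<psi> t))" if "t \<in> {- T<..<T}" for t
    proof -
      have "summable (\<lambda>j. \<bar>B j t\<bar>)"
        using B_le[of t] that by (intro summable_comparison_test'[OF sum1, of 0]) auto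
      then show ?thesis by (simp add: abs_mult summable_mult2)
    qed
    then show "AE t in M. summable (\<lambda>j. norm (B j t * deriv \<psi> t))" by (intro AE_I2) simp
    show "summable (\<lambda>j. \<integral>t. norm (B j t * deriv \<psi> t) \<partial>M)"
      by (rule summable_comparison_test'[OF summable_mult[OF sum1, of "2 * T * C'"], of 0]) (use le in auto)
  qed
  also have "(\<integral>t. (\<Sum>j. B j t * deriv \<psi> t) \<partial>M) = (\<integral>t. w t * deriv \<psi> t \<partial>M)"
    unfolding w_def
    by (rule Bochner_Integration.integral_cong[OF refl]) (auto intro!: suminf_mult2[symmetric] summable_B)
  finally have 1: "(\<lambda>j. \<integral>t. B j t * deriv \<psi> t \<partial>M) sums (\<integral>t. w t * deriv \<psi> t \<partial>M)" .
  have eq: "(\<integral>t. B j t * deriv \<psi> t \<partial>M) = - (\<integral>t. \<psi> t * \<beta> j t \<partial>M)" for j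
    using has_weak_derivD_test[OF has_weak_deriv_smooth[OF DERIV_B cont_\<beta>] \<psi> d, of j]
    by (simp add: mult.commute)
  have 2: "(\<lambda>j. - (\<integral>t. \<psi> t * \<beta> j t \<partial>M)) sums - (\<integral>t. \<psi> t * g t \<partial>M)"
    using C by (intro sums_minus integral_mult_\<beta>_sums m)
  show "(\<integral>t. w t * deriv \<psi> t \<partial>M) = - (\<integral>t. g t * \<psi> t \<partial>M)"
    using sums_unique2[OF 1[unfolded eq] 2] by (simp add: mult.commute)
qed

lemma w_sobolev: "w \<in> sobolev 2 (- T) T" "w \<in> sobolev 1 (- T) T"
proof -
  have iw: "integrable M w" by (rule has_weak_derivD(1)[OF has_weak_deriv_w])
  have "integrable M (\<lambda>t. w t * w t)"
    using bounded_w
    by (intro integrable_mult_bounded[OF iw measurable_w, where C="\<Sum>j. c j * (r j - l j)"]) auto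
  then have "mem_Lp 2 (- T) T w" "mem_Lp 1 (- T) T w"
    using iw measurable_w by (auto simp: mem_Lp_def abs_powr_2 power2_eq_square)
  moreover have "mem_Lp 2 (- T) T g" "mem_Lp 1 (- T) T g"
    using integrable_g integrable_g_square measurable_g by (auto simp: mem_Lp_def abs_powr_2)
  ultimately show "w \<in> sobolev 2 (- T) T" "w \<in> sobolev 1 (- T) T"
    unfolding sobolev_def using abs_continuous_w has_weak_deriv_w by auto
qed


lemma lagrangian_measurable:
  assumes \<phi>: "continuous_on ({- T..T} \<times> UNIV) \<phi>" and u: "u \<in> sobolev 1 (- T) T"
  shows "(\<lambda>t. lagrangian \<phi> w (t, u t, weak_deriv (- T) T u t)) \<in> borel_measurable M"
    and "integrable M (\<lambda>t. \<phi> (t, u t - w t))"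
proof -
  note wd = sobolev_has_weak_deriv[OF u] and cu = sobolev_continuous_on[OF u]
  have c\<phi>: "continuous_on {- T..T} (\<lambda>t. \<phi> (t, u t - w t))"
    by (rule continuous_on_compose2[OF \<phi>]) (auto intro!: continuous_intros cu continuous_w)
  then have m\<phi>: "(\<lambda>t. \<phi> (t, u t - w t)) \<in> borel_measurable M"
    by (intro continuous_imp_measurable_on_sets_lebesgue) (auto intro: continuous_on_subset)
  have "bounded ((\<lambda>t. \<phi> (t, u t - w t)) ` {- T..T})"
    by (intro compact_imp_bounded compact_continuous_image c\<phi>) simp
  then obtain C where C: "\<forall>y\<in>(\<lambda>t. \<phi> (t, u t - w t)) ` {- T..T}. norm y \<le> C" unfolding bounded_iff by blast
  show "integrable M (\<lambda>t. \<phi> (t, u t - w t))"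
    by (rule integrable_bounded_lebesgue_on[OF m\<phi>, where C=C]) (use C in auto)
  note [measurable] = m\<phi> has_weak_derivD(2)[OF wd, THEN borel_measurable_integrable]
  show "(\<lambda>t. lagrangian \<phi> w (t, u t, weak_deriv (- T) T u t)) \<in> borel_measurable M"
    unfolding lagrangian_def by simp
qed

text \<open>
  For \<open>u = w + z\<close> and \<open>p = z'\<close> the integral below is the energy of \<open>u\<close> minus that of \<open>w\<close>.  The
  inequalities for the first \<open>N\<close> bumps add up, their shares of \<open>p\<^sup>2\<close> amounting to at most
  \<open>p\<^sup>2\<close>; then \<open>N\<close> tends to infinity in the cross term, which is dominated by \<open>G\<^sup>2 + p\<^sup>2\<close>.
\<close>

lemma energy_excess_nonneg:
  assumes z: "continuous_on {- T..T} z" "has_weak_deriv (- T) T z p"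
    and p2: "integrable M (\<lambda>t. (p t)\<^sup>2)" and \<phi>: "integrable M \<phi>"
    and le: "\<And>N t. t \<in> {- T<..<T} \<Longrightarrow>
      (\<Sum>j<N. 2 * \<bar>\<beta>' j t\<bar> * min \<bar>z t\<bar> (4 * c j * (r j - l j) / \<alpha> j)) \<le> \<phi> t"
  shows "integrable M (\<lambda>t. g t * p t)" "0 \<le> (\<integral>t. \<phi> t + 2 * (g t * p t) + (p t)\<^sup>2 \<partial>M)"
proof -
  let ?\<phi> = "\<lambda>j t. 2 * \<bar>\<beta>' j t\<bar> * min \<bar>z t\<bar> (4 * c j * (r j - l j) / \<alpha> j)"
  note bump = single_bump_inequality[OF z(2,1) p2 DERIV_\<beta> cont_\<beta>' lr supp bd \<alpha>(1)]
  have ip: "integrable M p" by (rule has_weak_derivD(2)[OF z(2)])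
  note [measurable] = ip[THEN borel_measurable_integrable]
  have dom: "integrable M (\<lambda>t. (G t)\<^sup>2 + (p t)\<^sup>2)"
    using integrable_G_square p2 by auto
  have AM: "\<bar>x * y\<bar> \<le> z\<^sup>2 + y\<^sup>2" if "\<bar>x\<bar> \<le> z" for x y z :: real
  proof -
    have "\<bar>x\<bar> * \<bar>y\<bar> \<le> z * \<bar>y\<bar>" using that by (intro mult_right_mono) auto
    moreover have "0 \<le> (z - \<bar>y\<bar>)\<^sup>2 + z\<^sup>2 + y\<^sup>2" by simp
    ultimately show ?thesis by (simp add: abs_mult power2_eq_square algebra_simps)
  qed
  show gp: "integrable M (\<lambda>t. g t * p t)"
  proof (rule Bochner_Integration.integrable_bound[OF dom])
    show "AE t in M. norm (g t * p t) \<le> norm ((G t)\<^sup>2 + (p t)\<^sup>2)"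
      using AE_g_le_G by eventually_elim (auto intro: AM)
  qed measurable
  have lim: "(\<lambda>N. \<integral>t. (\<Sum>j<N. \<beta> j t) * p t \<partial>M) \<longlonglongrightarrow> (\<integral>t. g t * p t \<partial>M)"
  proof (rule integral_dominated_convergence[OF _ _ dom])
    show "AE t in M. norm ((\<Sum>j<N. \<beta> j t) * p t) \<le> (G t)\<^sup>2 + (p t)\<^sup>2" for N
      using AE_g_le_G by eventually_elim (auto intro: AM)
    show "AE t in M. (\<lambda>N. (\<Sum>j<N. \<beta> j t) * p t) \<longlonglongrightarrow> g t * p t"
      using AE_g_le_G by eventually_elim (auto intro: tendsto_mult)
  qed measurable
  have "0 \<le> (\<integral>t. \<phi> t \<partial>M) + 2 * (\<integral>t. (\<Sum>j<N. \<beta> j t) * p t \<partial>M) + (\<integral>t. (p t)\<^sup>2 \<partial>M)" for N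
  proof -
    have i1: "integrable M (\<lambda>t. ?\<phi> j t + 2 * (\<beta> j t * p t) + \<alpha> j * (p t)\<^sup>2)" for j
      using bump(1,2)[of j] p2 by auto
    have iS: "integrable M (\<lambda>t. (\<Sum>j<N. \<beta> j t) * p t)"
      using bump(2) by (simp add: sum_distrib_right)
    have "0 \<le> (\<Sum>j<N. \<integral>t. ?\<phi> j t + 2 * (\<beta> j t * p t) + \<alpha> j * (p t)\<^sup>2 \<partial>M)"
      using bump(3) by (intro sum_nonneg) auto
    also have "\<dots> = (\<integral>t. (\<Sum>j<N. ?\<phi> j t + 2 * (\<beta> j t * p t) + \<alpha> j * (p t)\<^sup>2) \<partial>M)"
      by (rule Bochner_Integration.integral_sum[OF i1, symmetric])
    also have "\<dots> \<le> (\<integral>t. \<phi> t + 2 * ((\<Sum>j<N. \<beta> j t) * p t) + (p t)\<^sup>2 \<partial>M)"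
    proof (rule integral_mono)
      show "integrable M (\<lambda>t. \<phi> t + 2 * ((\<Sum>j<N. \<beta> j t) * p t) + (p t)\<^sup>2)"
        using \<phi> iS p2 by auto
      fix t assume t: "t \<in> space M"
      have "(\<Sum>j<N. \<alpha> j) \<le> 1"
        using sum_le_suminf[OF \<alpha>(2), of "{..<N}"] \<alpha>(1,3) by (auto simp: less_imp_le intro: order_trans)
      then have "(\<Sum>j<N. \<alpha> j) * (p t)\<^sup>2 \<le> 1 * (p t)\<^sup>2" by (intro mult_right_mono) auto
      moreover have "(\<Sum>j<N. ?\<phi> j t + 2 * (\<beta> j t * p t) + \<alpha> j * (p t)\<^sup>2)
          = (\<Sum>j<N. ?\<phi> j t) + 2 * ((\<Sum>j<N. \<beta> j t) * p t) + (\<Sum>j<N. \<alpha> j) * (p t)\<^sup>2"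
        by (simp add: sum.distrib sum_distrib_left sum_distrib_right)
      ultimately show "(\<Sum>j<N. ?\<phi> j t + 2 * (\<beta> j t * p t) + \<alpha> j * (p t)\<^sup>2)
          \<le> \<phi> t + 2 * ((\<Sum>j<N. \<beta> j t) * p t) + (p t)\<^sup>2"
        using le[of t N] t by simp
    qed (use i1 in auto)
    finally show ?thesis using \<phi> iS p2 by simp
  qed
  then have "0 \<le> (\<integral>t. \<phi> t \<partial>M) + 2 * (\<integral>t. g t * p t \<partial>M) + (\<integral>t. (p t)\<^sup>2 \<partial>M)"
    by (intro LIMSEQ_le_const[OF tendsto_add[OF tendsto_add[OF tendsto_const tendsto_mult[OF tendsto_const lim]] tendsto_const]]) auto
  then show "0 \<le> (\<integral>t. \<phi> t + 2 * (g t * p t) + (p t)\<^sup>2 \<partial>M)"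
    using \<phi> gp p2 by simp
qed

text \<open>
  A competitor whose derivative is not square integrable has infinite energy.  For all others
  \<open>(u')\<^sup>2 = (w')\<^sup>2 + 2 w' p + p\<^sup>2\<close> with \<open>p = u' - w'\<close>, and by uniqueness of weak derivatives
  \<open>w'\<close> may be replaced by \<open>g\<close>.
\<close>

theorem w_minimizer:
  assumes \<phi>: "continuous_on ({- T..T} \<times> UNIV) \<phi>" and \<phi>0: "\<And>t. t \<in> {- T<..<T} \<Longrightarrow> \<phi> (t, 0) = 0"
    and le: "\<And>N t y. t \<in> {- T<..<T} \<Longrightarrow>
      (\<Sum>j<N. 2 * \<bar>\<beta>' j t\<bar> * min \<bar>y\<bar> (4 * c j * (r j - l j) / \<alpha> j)) \<le> \<phi> (t, y)"
  shows "minimizer_over (int_functional T (lagrangian \<phi> w)) (admissible T (w (- T)) (w T)) w"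
  unfolding minimizer_over_def
proof (intro conjI ballI)
  show "w \<in> admissible T (w (- T)) (w T)"
    using w_sobolev by (simp add: admissible_def)
  fix u assume "u \<in> admissible T (w (- T)) (w T)"
  then have u: "u \<in> sobolev 1 (- T) T" by (simp add: admissible_def)
  define w' u' where "w' = weak_deriv (- T) T w" and "u' = weak_deriv (- T) T u"
  note wu = sobolev_has_weak_deriv[OF u, folded u'_def]
  note ww = sobolev_has_weak_deriv[OF w_sobolev(2), folded w'_def]
  note i\<phi>u = lagrangian_measurable(2)[OF \<phi> u]
  note [measurable] = wu[THEN has_weak_derivD(2), THEN borel_measurable_integrable]
    ww[THEN has_weak_derivD(2), THEN borel_measurable_integrable]
    i\<phi>u[THEN borel_measurable_integrable]
  define z p where "z t = u t - w t" and "p t = u' t - w' t" for t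
  have \<phi>_nonneg: "0 \<le> \<phi> (t, y)" if "t \<in> {- T<..<T}" for t y
    using le[OF that, where N=0 and y=y] by simp
  have Lw: "int_functional T (lagrangian \<phi> w) w = (\<integral>\<^sup>+t. ennreal ((w' t)\<^sup>2) \<partial>M)"
    unfolding int_functional_def lagrangian_def w'_def
    by (rule nn_integral_cong) (simp add: \<phi>0)
  have Lu: "int_functional T (lagrangian \<phi> w) u = (\<integral>\<^sup>+t. ennreal (\<phi> (t, z t) + (u' t)\<^sup>2) \<partial>M)"
    unfolding int_functional_def lagrangian_def u'_def z_def by simp
  have ae: "AE t in M. w' t = g t"
    by (rule has_weak_deriv_unique[OF ww has_weak_deriv_w])
  have iw': "integrable M (\<lambda>t. (w' t)\<^sup>2)"
    using integrable_g_square
    by (rule integrable_cong_AE[THEN iffD1, rotated 3]) (use ae in \<open>auto elim!: eventually_mono\<close>)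
  show "int_functional T (lagrangian \<phi> w) w \<le> int_functional T (lagrangian \<phi> w) u"
  proof (cases "integrable M (\<lambda>t. (u' t)\<^sup>2)")
    case False
    then have "(\<integral>\<^sup>+t. ennreal ((u' t)\<^sup>2) \<partial>M) = \<infinity>"
      by (subst (asm) integrable_iff_bounded) (auto simp: less_top[symmetric])
    moreover have "(\<integral>\<^sup>+t. ennreal ((u' t)\<^sup>2) \<partial>M) \<le> int_functional T (lagrangian \<phi> w) u"
      unfolding Lu using \<phi>_nonneg by (intro nn_integral_mono ennreal_leI) auto
    ultimately show ?thesis by (simp add: top_unique)
  next
    case True
    have p2: "integrable M (\<lambda>t. (p t)\<^sup>2)"
    proof (rule Bochner_Integration.integrable_bound)
      show "integrable M (\<lambda>t. 2 * (u' t)\<^sup>2 + 2 * (w' t)\<^sup>2)" using True iw' by auto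
      have "norm ((p t)\<^sup>2) \<le> norm (2 * (u' t)\<^sup>2 + 2 * (w' t)\<^sup>2)" for t
      proof -
        have "0 \<le> (u' t + w' t)\<^sup>2" by simp
        also have "\<dots> = 2 * (u' t)\<^sup>2 + 2 * (w' t)\<^sup>2 - (p t)\<^sup>2"
          by (simp add: p_def power2_eq_square algebra_simps)
        finally show ?thesis by simp
      qed
      then show "AE t in M. norm ((p t)\<^sup>2) \<le> norm (2 * (u' t)\<^sup>2 + 2 * (w' t)\<^sup>2)" by simp
    qed (simp add: p_def)
    have "continuous_on {- T..T} z"
      unfolding z_def[abs_def] by (intro continuous_intros sobolev_continuous_on[OF u] continuous_w)
    moreover have "has_weak_deriv (- T) T z p"
      unfolding z_def[abs_def] p_def[abs_def] by (rule has_weak_deriv_diff[OF wu ww])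
    moreover have i\<phi>: "integrable M (\<lambda>t. \<phi> (t, z t))"
      using i\<phi>u by (simp add: z_def)
    ultimately have ex: "integrable M (\<lambda>t. g t * p t)"
      "0 \<le> (\<integral>t. \<phi> (t, z t) + 2 * (g t * p t) + (p t)\<^sup>2 \<partial>M)"
      using energy_excess_nonneg[of z p "\<lambda>t. \<phi> (t, z t)"] p2 le by auto
    have "(\<integral>t. (w' t)\<^sup>2 \<partial>M)
        \<le> (\<integral>t. (w' t)\<^sup>2 \<partial>M) + (\<integral>t. \<phi> (t, z t) + 2 * (g t * p t) + (p t)\<^sup>2 \<partial>M)"
      using ex(2) by simp
    also have "\<dots> = (\<integral>t. (w' t)\<^sup>2 + (\<phi> (t, z t) + 2 * (g t * p t) + (p t)\<^sup>2) \<partial>M)"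
      by (rule Bochner_Integration.integral_add[symmetric]) (use iw' ex(1) i\<phi> p2 in auto)
    also have "\<dots> = (\<integral>t. \<phi> (t, z t) + (u' t)\<^sup>2 \<partial>M)"
    proof (rule integral_cong_AE)
      show "AE t in M. (w' t)\<^sup>2 + (\<phi> (t, z t) + 2 * (g t * p t) + (p t)\<^sup>2) = \<phi> (t, z t) + (u' t)\<^sup>2"
        using ae by eventually_elim (simp add: p_def power2_eq_square algebra_simps)
      show "(\<lambda>t. (w' t)\<^sup>2 + (\<phi> (t, z t) + 2 * (g t * p t) + (p t)\<^sup>2)) \<in> borel_measurable M"
        using iw' ex(1) i\<phi> p2 by (intro borel_measurable_integrable) auto
      show "(\<lambda>t. \<phi> (t, z t) + (u' t)\<^sup>2) \<in> borel_measurable M"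
        using i\<phi> True by (intro borel_measurable_integrable) auto
    qed
    finally have "(\<integral>t. (w' t)\<^sup>2 \<partial>M) \<le> (\<integral>t. \<phi> (t, z t) + (u' t)\<^sup>2 \<partial>M)" .
    moreover have "(\<integral>\<^sup>+t. ennreal ((w' t)\<^sup>2) \<partial>M) = ennreal (\<integral>t. (w' t)\<^sup>2 \<partial>M)"
      by (rule nn_integral_eq_integral[OF iw']) simp
    moreover have "(\<integral>\<^sup>+t. ennreal (\<phi> (t, z t) + (u' t)\<^sup>2) \<partial>M) = ennreal (\<integral>t. \<phi> (t, z t) + (u' t)\<^sup>2 \<partial>M)"
      by (rule nn_integral_eq_integral) (use i\<phi> True \<phi>_nonneg in auto)
    ultimately show ?thesis
      unfolding Lw Lu by (simp add: ennreal_leI)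
  qed
qed

end

section \<open>Numerical series and series of functions\<close>

text \<open>
  Oscillates between arbitrarily large positive and negative values, but so slowly that its
  derivative is of order \<open>ln x / x\<close>.
\<close>

definition osc :: "real \<Rightarrow> real" where "osc x = ln (1 + x) * sin (ln (1 + x))"

lemma osc_diff_le:
  assumes "0 \<le> x" "x \<le> y"
  obtains z where "x \<le> z" "z \<le> y" "\<bar>osc y - osc x\<bar> \<le> (y - x) * ((1 + ln (1 + z)) / (1 + z))"
proof (cases "x = y")
  case True
  then show ?thesis using that[of x] by simp
next
  case False
  define osc' where "osc' z = ( (sin (ln (1 + z)) + ln (1 + z) * cos (ln (1 + z))) / (1 + z))" for z :: real
  have "(osc has_real_derivative osc' z) (at z)" if "x \<le> z" for z
    unfolding osc_def[abs_def] osc'_def using assms that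
    by (auto intro!: derivative_eq_intros simp: add_divide_distrib)
  then obtain z where z: "x < z" "z < y" "osc y - osc x = (y - x) * osc' z"
    using MVT2[of x y osc osc'] assms False by auto
  have L: "0 \<le> ln (1 + z)" using z assms by simp
  have "\<bar>osc' z\<bar> \<le> (1 + ln (1 + z)) / (1 + z)"
  proof -
    have "\<bar>ln (1 + z) * cos (ln (1 + z))\<bar> \<le> ln (1 + z)"
      using L by (simp add: abs_mult mult_left_le)
    then have "\<bar>sin (ln (1 + z)) + ln (1 + z) * cos (ln (1 + z))\<bar> \<le> 1 + ln (1 + z)"
      using abs_sin_le_one[of "ln (1 + z)"] by linarith
    then show ?thesis
      unfolding osc'_def using z assms by (simp add: divide_right_mono)
  qed
  then have "(y - x) * \<bar>osc' z\<bar> \<le> (y - x) * ((1 + ln (1 + z)) / (1 + z))"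
    using assms by (intro mult_left_mono) auto
  then show ?thesis
    using that[of z] z assms by (simp add: abs_mult)
qed

text \<open>
  The \<open>c k\<close> are the increments of \<open>osc\<close> at the integers, of order \<open>ln k / k\<close>, and \<open>a k\<close> is
  proportional to \<open>k powr (-3/2)\<close>.  The series of the ratios \<open>(c k)\<^sup>2 / a k\<close> necessarily
  diverges: if it converged, the Cauchy-Schwarz inequality would bound the partial sums of \<open>c\<close>.
  That the ratios tend to \<open>0\<close> is the most one can have.
\<close>

lemma oscillating_series:
  obtains c a :: "nat \<Rightarrow> real"
  where "\<And>k. 0 < a k" "summable a" "(\<Sum>k. a k) \<le> 1" "(\<lambda>k. (c k)\<^sup>2 / a k) \<longlonglongrightarrow> 0"
    and "\<And>C N. \<exists>K\<ge>N. C < (\<Sum>k\<le>K. c k)" "\<And>C N. \<exists>K\<ge>N. (\<Sum>k\<le>K. c k) < C"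
proof
  define a0 where "a0 k = real (Suc k) powr (- 3/2)" for k
  define S where "S = suminf a0"
  have s: "summable a0"
  proof -
    have "summable (\<lambda>k. real k powr (- 3/2))" by (simp add: summable_real_powr_iff)
    then show ?thesis unfolding a0_def by (subst summable_Suc_iff)
  qed
  have a0: "0 < a0 k" for k by (simp add: a0_def)
  have S: "0 < S" unfolding S_def using s a0 by (intro suminf_pos)
  let ?a = "\<lambda>k. a0 k / S" and ?c = "\<lambda>k. osc (real k + 1) - osc (real k)"
  show "0 < ?a k" for k using a0 S by simp
  show "summable ?a" by (rule summable_divide[OF s])
  show "(\<Sum>k. ?a k) \<le> 1" using suminf_divide[OF s, of S] S by (simp add: S_def)
  have c: "\<bar>?c k\<bar> \<le> (1 + ln (2 + real k)) / (1 + real k)" for k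
  proof -
    obtain z where z: "real k \<le> z" "z \<le> real k + 1" "\<bar>?c k\<bar> \<le> (1 + ln (1 + z)) / (1 + z)"
      using osc_diff_le[of "real k" "real k + 1"] by auto
    have "(1 + ln (1 + z)) / (1 + z) \<le> (1 + ln (2 + real k)) / (1 + real k)"
      using z by (intro frac_le) auto
    then show ?thesis using z by linarith
  qed
  show "(\<lambda>k. (?c k)\<^sup>2 / ?a k) \<longlonglongrightarrow> 0"
  proof (rule tendsto_sandwich[of "\<lambda>k. 0", OF _ _ tendsto_const])
    show "eventually (\<lambda>k. 0 \<le> (?c k)\<^sup>2 / ?a k) sequentially"
      using a0 S by (simp add: less_imp_le)
    let ?u = "\<lambda>k. S * ((1 + ln (2 + real k)) / (1 + real k))\<^sup>2 * (1 + real k) powr (3/2)"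
    have "(?c k)\<^sup>2 / ?a k \<le> ?u k" for k
    proof -
      have "(?c k)\<^sup>2 \<le> ((1 + ln (2 + real k)) / (1 + real k))\<^sup>2"
        using power_mono[OF c[of k], of 2] by simp
      moreover have "1 / ?a k = S * (1 + real k) powr (3/2)"
        by (simp add: a0_def powr_minus divide_simps add.commute)
      ultimately have "(?c k)\<^sup>2 * (1 / ?a k) \<le> ((1 + ln (2 + real k)) / (1 + real k))\<^sup>2 * (S * (1 + real k) powr (3/2))"
        using S by (intro mult_mono) auto
      then show ?thesis by (simp add: mult_ac)
    qed
    then show "eventually (\<lambda>k. (?c k)\<^sup>2 / ?a k \<le> ?u k) sequentially" by simp
    show "?u \<longlonglongrightarrow> 0" by real_asymp
  qed
  have sum: "(\<Sum>k\<le>K. ?c k) = osc (real (Suc K))" for K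
    by (induction K) (auto simp: osc_def add.commute)
  \<comment> \<open>The partial sums are values of \<open>osc\<close> at integers; its peaks lie elsewhere, but \<open>osc\<close> has
    Lipschitz constant \<open>1\<close>.\<close>
  have near: "\<exists>K\<ge>N. \<bar>(\<Sum>k\<le>K. ?c k) - osc x\<bar> \<le> 1" if x: "real N + 1 \<le> x" for x N
  proof -
    define K where "K = nat \<lceil>x\<rceil> - 1"
    have K: "real (Suc K) = of_int \<lceil>x\<rceil>" using x unfolding K_def by linarith
    then have "x \<le> real (Suc K)" "real (Suc K) \<le> x + 1" by linarith+
    moreover obtain z where z: "x \<le> z" "\<bar>osc (real (Suc K)) - osc x\<bar> \<le> (real (Suc K) - x) * ((1 + ln (1 + z)) / (1 + z))"
      using osc_diff_le[of x "real (Suc K)"] calculation x by auto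
    moreover have "(1 + ln (1 + z)) / (1 + z) \<le> 1"
      using ln_add_one_self_le_self[of z] z x by simp
    moreover have "0 \<le> (1 + ln (1 + z)) / (1 + z)"
      using z x by simp
    ultimately have "\<bar>osc (real (Suc K)) - osc x\<bar> \<le> 1 * 1"
      by (intro order_trans[OF z(2) mult_mono]) auto
    moreover have "N \<le> K" using \<open>x \<le> real (Suc K)\<close> x by simp
    ultimately show ?thesis using sum[of K] by auto
  qed
  have big: "real n \<le> exp (of_nat n * (2 * pi) + r) - 1" "real n \<le> of_nat n * (2 * pi) + r"
    if "0 \<le> r" for n r
  proof -
    have "real n * 1 \<le> of_nat n * (2 * pi)" using pi_gt3 by (intro mult_left_mono) auto
    then show "real n \<le> of_nat n * (2 * pi) + r" using that by simp
    then show "real n \<le> exp (of_nat n * (2 * pi) + r) - 1"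
      using exp_ge_add_one_self[of "of_nat n * (2 * pi) + r"] by linarith
  qed
  have cos_n2pi: "cos (real n * (2 * pi)) = 1" and sin_n2pi: "sin (real n * (2 * pi)) = 0" for n
    using cos_2npi[of n] sin_2npi[of n] by (simp_all add: mult.assoc mult.left_commute[of "real n"])
  have osc_exp: "osc (exp y - 1) = y * sin y" for y by (simp add: osc_def)
  fix C :: real and N :: nat
  obtain n where n: "real N + 1 \<le> real n" "\<bar>C\<bar> + 2 \<le> real n"
    using real_arch_simple[of "max (real N + 1) (\<bar>C\<bar> + 2)"] by auto
  show "\<exists>K\<ge>N. C < (\<Sum>k\<le>K. ?c k)"
  proof -
    let ?y = "of_nat n * (2 * pi) + pi / 2"
    have sin1: "sin ?y = 1" by (simp add: sin_add cos_n2pi sin_n2pi)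
    have "real N + 1 \<le> exp ?y - 1" using n big(1)[of "pi / 2" n] by simp
    from near[OF this] obtain K where K: "K \<ge> N" "\<bar>(\<Sum>k\<le>K. ?c k) - osc (exp ?y - 1)\<bar> \<le> 1" by blast
    have "C < (\<Sum>k\<le>K. ?c k)"
      using K(2) n big(2)[of "pi / 2" n] unfolding osc_exp sin1 by simp
    then show ?thesis using K by blast
  qed
  show "\<exists>K\<ge>N. (\<Sum>k\<le>K. ?c k) < C"
  proof -
    let ?y = "of_nat n * (2 * pi) + 3 * pi / 2"
    have "sin (3 * pi / 2) = -1" using sin_3over2_pi by (simp add: mult.commute)
    then have sin1: "sin ?y = - 1" by (simp add: sin_add cos_n2pi sin_n2pi)
    have "real N + 1 \<le> exp ?y - 1" using n big(1)[of "3 * pi / 2" n] by simp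
    from near[OF this] obtain K where K: "K \<ge> N" "\<bar>(\<Sum>k\<le>K. ?c k) - osc (exp ?y - 1)\<bar> \<le> 1" by blast
    have "(\<Sum>k\<le>K. ?c k) < C"
      using K(2) n big(2)[of "3 * pi / 2" n] unfolding osc_exp sin1 by simp
    then show ?thesis using K by blast
  qed
qed

lemma suminf_of_at_most_one_nonzero:
  fixes f :: "nat \<Rightarrow> real"
  assumes "\<And>i j. f i \<noteq> 0 \<Longrightarrow> f j \<noteq> 0 \<Longrightarrow> i = j"
  obtains k where "summable f" "suminf f = f k" "\<And>N. (\<Sum>i<N. f i) = (if k < N then f k else 0)"
proof -
  obtain k where k: "\<And>i. i \<noteq> k \<Longrightarrow> f i = 0"
    using assms by metis
  then have "f sums f k"
    using sums_finite[of "{k}" f] by auto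
  moreover have "(\<Sum>i<N. f i) = (\<Sum>i<N. if i = k then f k else 0)" for N
    using k by (intro sum.cong) auto
  ultimately show ?thesis
    by (intro that[of k]) (auto simp: sums_iff)
qed

text \<open>
  At each point the sum and its partial sums differ by at most one term, so uniform convergence
  only depends on \<open>m \<longlonglongrightarrow> 0\<close>.
\<close>

lemma continuous_on_suminf_disjoint_supports:
  fixes f :: "nat \<Rightarrow> 'a::topological_space \<Rightarrow> real"
  assumes cont: "\<And>k. continuous_on S (f k)" and m: "\<And>k x. x \<in> S \<Longrightarrow> \<bar>f k x\<bar> \<le> m k" "m \<longlonglongrightarrow> 0"
    and disj: "\<And>i j x. f i x \<noteq> 0 \<Longrightarrow> f j x \<noteq> 0 \<Longrightarrow> i = j"
  shows "continuous_on S (\<lambda>x. \<Sum>k. f k x)"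
proof (rule uniform_limit_theorem)
  show "eventually (\<lambda>N. continuous_on S (\<lambda>x. \<Sum>k<N. f k x)) sequentially"
    by (intro always_eventually allI continuous_intros cont)
  show "uniform_limit S (\<lambda>N x. \<Sum>k<N. f k x) (\<lambda>x. \<Sum>k. f k x) sequentially"
  proof (rule uniform_limitI)
    fix e :: real assume e: "0 < e"
    then have "eventually (\<lambda>k. m k < e) sequentially"
      using m(2) by (intro order_tendstoD)
    then obtain N where N: "\<And>k. k \<ge> N \<Longrightarrow> m k < e"
      by (auto simp: eventually_sequentially)
    have "dist (\<Sum>k<n. f k x) (\<Sum>k. f k x) < e" if "n \<ge> N" "x \<in> S" for n x
    proof -
      obtain k where k: "(\<Sum>k. f k x) = f k x" "\<And>n. (\<Sum>i<n. f i x) = (if k < n then f k x else 0)"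
        using suminf_of_at_most_one_nonzero[of "\<lambda>k. f k x"] disj by metis
      show ?thesis
        using m(1)[OF that(2), of k] N[of k] that(1) e by (cases "k < n") (auto simp: k dist_real_def)
    qed
    then show "eventually (\<lambda>n. \<forall>x\<in>S. dist (\<Sum>k<n. f k x) (\<Sum>k. f k x) < e) sequentially"
      by (auto simp: eventually_sequentially)
  qed
qed simp

text \<open>
  Both components of \<open>prod_decode j\<close> are at most \<open>j\<close>, so the first \<open>N\<close> pairs lie in a square of
  side \<open>N\<close>.
\<close>

lemma sum_prod_decode_le:
  fixes h :: "nat \<times> nat \<Rightarrow> real"
  assumes "\<And>p. 0 \<le> h p"
  shows "(\<Sum>j<N. h (prod_decode j)) \<le> (\<Sum>n<N. \<Sum>k<N. h (n, k))"
proof -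
  have "(\<Sum>j<N. h (prod_decode j)) = sum h (prod_decode ` {..<N})"
    by (simp add: sum.reindex inj_prod_decode)
  also have "\<dots> \<le> sum h ({..<N} \<times> {..<N})"
  proof (rule sum_mono2)
    have le: "fst (prod_decode j) \<le> j" "snd (prod_decode j) \<le> j" for j
      using le_prod_encode_1[of "fst (prod_decode j)" "snd (prod_decode j)"]
        le_prod_encode_2[of "snd (prod_decode j)" "fst (prod_decode j)"] by simp_all
    show "prod_decode ` {..<N} \<subseteq> {..<N} \<times> {..<N}"
    proof
      fix p assume "p \<in> prod_decode ` {..<N}"
      then obtain j where "p = prod_decode j" "j < N" by auto
      then show "p \<in> {..<N} \<times> {..<N}" using le[of j] by (simp add: mem_Times_iff)
    qed
  qed (use assms in auto)
  finally show ?thesis by (simp add: sum.cartesian_product)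
qed

lemma summable_prod_decode:
  fixes x y :: "nat \<Rightarrow> real"
  assumes x: "\<And>n. 0 \<le> x n" "summable x" and y: "\<And>k. 0 \<le> y k" "summable y"
  shows "summable (\<lambda>j. x (fst (prod_decode j)) * y (snd (prod_decode j)))" (is "summable ?z")
    and "(\<Sum>j. x (fst (prod_decode j)) * y (snd (prod_decode j))) \<le> suminf x * suminf y"
proof -
  have le: "(\<Sum>j<N. ?z j) \<le> suminf x * suminf y" for N
  proof -
    have "(\<Sum>j<N. ?z j) \<le> (\<Sum>n<N. \<Sum>k<N. x n * y k)"
      using sum_prod_decode_le[of "\<lambda>(n, k). x n * y k" N] x y by (auto simp: case_prod_beta)
    also have "\<dots> = (\<Sum>n<N. x n) * (\<Sum>k<N. y k)"
      by (simp add: sum_product)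
    also have "\<dots> \<le> suminf x * suminf y"
      using x y by (intro mult_mono sum_le_suminf suminf_nonneg sum_nonneg) auto
    finally show ?thesis .
  qed
  show s: "summable ?z"
    using x y le by (intro summableI_nonneg_bounded[where x="suminf x * suminf y"]) auto
  show "suminf ?z \<le> suminf x * suminf y"
    by (rule suminf_le_const[OF s le])
qed

section \<open>Infinite Dini derivatives and dense sequences\<close>

lemma Limsup_at_eq_PInfty:
  fixes f :: "real \<Rightarrow> real"
  assumes "\<And>C d. 0 < d \<Longrightarrow> \<exists>s. s \<noteq> t \<and> \<bar>s - t\<bar> < d \<and> C < f s"
  shows "Limsup (at t) (\<lambda>s. ereal (f s)) = \<infinity>"
proof -
  have "(SUP s\<in>Collect P. ereal (f s)) = \<infinity>" if P: "eventually P (at t)" for P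
  proof -
    obtain d where d: "0 < d" "\<And>s. s \<noteq> t \<Longrightarrow> \<bar>s - t\<bar> < d \<Longrightarrow> P s"
      using P unfolding eventually_at dist_real_def by blast
    have "\<exists>s\<in>Collect P. ereal (real n) \<le> ereal (f s)" for n :: nat
      using assms[OF d(1), of "real n"] d(2) by (auto intro: less_imp_le)
    then show ?thesis by (intro SUP_PInfty)
  qed
  then show ?thesis
    unfolding Limsup_def by (simp add: top_ereal_def[symmetric] INF_eq_const)
qed

lemma Liminf_at_eq_MInfty:
  fixes f :: "real \<Rightarrow> real"
  assumes "\<And>C d. 0 < d \<Longrightarrow> \<exists>s. s \<noteq> t \<and> \<bar>s - t\<bar> < d \<and> f s < C"
  shows "Liminf (at t) (\<lambda>s. ereal (f s)) = - \<infinity>"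
proof -
  have "\<exists>s. s \<noteq> t \<and> \<bar>s - t\<bar> < d \<and> C < - f s" if "0 < d" for C d
    using assms[OF that, of "- C"] by (simp add: less_minus_iff)
  then have "Limsup (at t) (\<lambda>s. ereal (- f s)) = \<infinity>"
    by (rule Limsup_at_eq_PInfty)
  then show ?thesis
    using ereal_Limsup_uminus[of "at t" "\<lambda>s. ereal (f s)"]
    by (cases "Liminf (at t) (\<lambda>s. ereal (f s))") auto
qed

lemma dense_sequence:
  obtains q :: "nat \<Rightarrow> real" where "inj q" "range q \<subseteq> {-1<..<1}" "closure (range q) = {-1..1}"
proof -
  define Q :: "real set" where "Q = {-1<..<1} \<inter> \<rat>"
  have cl: "closure Q = {-1..1}"
    unfolding Q_def by (subst closure_open_Int_superset) (auto simp: Rats_closure_real)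
  have "countable Q" unfolding Q_def by (simp add: countable_rat)
  moreover have "infinite Q"
  proof
    assume "finite Q"
    then have "closure Q = Q" by (simp add: finite_imp_closed)
    then show False using cl by (auto simp: Q_def)
  qed
  ultimately have "bij_betw (from_nat_into Q) UNIV Q" by (rule bij_betw_from_nat_into)
  then show ?thesis
    using that[of "from_nat_into Q"] cl by (auto simp: bij_betw_def Q_def)
qed

section \<open>The basic bump and its primitive\<close>

text \<open>
  Equal to \<open>1\<close> on \<open>[-1/2, 1/2]\<close> and to \<open>0\<close> off \<open>[-1, 1]\<close>.
\<close>

definition bump :: "real \<Rightarrow> real" where "bump = plateau (-1) (1/2) (1/2)"

definition bump' :: "real \<Rightarrow> real" where "bump' = plateau' (-1) (1/2) (1/2)"

definition step_primitive :: "real \<Rightarrow> real" where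
  "step_primitive x = 2/3 * (max 0 x)^3 - 4/3 * (max 0 (x - 1/2))^3 + 2/3 * (max 0 (x - 1))^3"

definition bump_primitive :: "real \<Rightarrow> real" where
  "bump_primitive x = (step_primitive (2 * x + 2) - step_primitive (2 * x - 1)) / 2"

lemma DERIV_step_primitive: "(step_primitive has_real_derivative step x) (at x)"
proof -
  have *: "((\<lambda>x::real. (max 0 (x - a))^3) has_real_derivative 3 * (max 0 (x - a))\<^sup>2) (at x)" for a
    using DERIV_pos_part_power_shift[of 2 a x] by (simp add: numeral_3_eq_3)
  show ?thesis
    unfolding step_primitive_def[abs_def] step_def
    by (rule derivative_eq_intros *[of 0, simplified] * refl)+ simp
qed

lemma DERIV_bump: "(bump has_real_derivative bump' x) (at x)"
  unfolding bump_def bump'_def by (rule DERIV_plateau) simp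

lemma DERIV_bump_primitive: "(bump_primitive has_real_derivative bump x) (at x)"
proof -
  have "((\<lambda>x. step_primitive (2 * x + s)) has_real_derivative step (2 * x + s) * 2) (at x)" for s
    by (rule DERIV_chain2[OF DERIV_step_primitive]) (auto intro!: derivative_eq_intros)
  from DERIV_cdivide[OF DERIV_diff[OF this[of 2] this[of "-1"]], of 2]
  show ?thesis
    unfolding bump_primitive_def[abs_def] bump_def plateau_def by (simp add: algebra_simps diff_divide_distrib)
qed

lemma continuous_on_bump': "continuous_on S bump'"
  unfolding bump'_def by (rule continuous_on_plateau') simp

lemma bump_bounds: "0 \<le> bump x" "bump x \<le> 1"
  unfolding bump_def by (rule plateau_bounds; simp)+

lemma bump_eq_0: "x \<notin> {-1..1} \<Longrightarrow> bump x = 0"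
  unfolding bump_def by (rule plateau_eq_0) auto

lemma bump_eq_1: "\<bar>x\<bar> \<le> 1/2 \<Longrightarrow> bump x = 1"
  unfolding bump_def plateau_def by (auto simp: step_eq_0 step_eq_1)

lemma bump'_bound: "\<bar>bump' x\<bar> \<le> 4"
  using step'_bounds[of "(x - -1) / (1/2)"] step'_bounds[of "(x - 1/2) / (1/2)"]
  unfolding bump'_def plateau'_def by (auto simp: abs_le_iff)

lemma bump'_nonzeroD: "bump' x \<noteq> 0 \<Longrightarrow> 1/2 < \<bar>x\<bar> \<and> \<bar>x\<bar> < 1"
proof (rule ccontr)
  assume "bump' x \<noteq> 0" and "\<not> (1/2 < \<bar>x\<bar> \<and> \<bar>x\<bar> < 1)"
  then have "(x + 1) * 2 \<le> 0 \<or> 1 \<le> (x + 1) * 2" "(x - 1/2) * 2 \<le> 0 \<or> 1 \<le> (x - 1/2) * 2"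
    by (auto simp: abs_if split: if_splits)
  then show False
    using \<open>bump' x \<noteq> 0\<close> by (simp add: bump'_def plateau'_def step'_eq_0)
qed

lemma bump_primitive_eq_0: "x \<le> -1 \<Longrightarrow> bump_primitive x = 0"
  by (simp add: bump_primitive_def step_primitive_def)

lemma bump_primitive_mvt:
  obtains z where "min x y \<le> z" "z \<le> max x y" "bump_primitive x - bump_primitive y = (x - y) * bump z"
proof (cases x y rule: linorder_cases)
  case less
  then obtain z where "x < z" "z < y" "bump_primitive y - bump_primitive x = (y - x) * bump z"
    using MVT2[of x y bump_primitive bump] DERIV_bump_primitive by auto
  then show ?thesis using that[of z] by (simp add: algebra_simps)
next
  case equal
  then show ?thesis using that[of x] by simp
next
  case greater
  then obtain z where "y < z" "z < x" "bump_primitive x - bump_primitive y = (x - y) * bump z"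
    using MVT2[of y x bump_primitive bump] DERIV_bump_primitive by auto
  then show ?thesis using that[of z] by simp
qed

lemma bump_primitive_lipschitz: "\<bar>bump_primitive x - bump_primitive y\<bar> \<le> \<bar>x - y\<bar>"
proof -
  obtain z where "bump_primitive x - bump_primitive y = (x - y) * bump z"
    using bump_primitive_mvt by blast
  then show ?thesis using bump_bounds[of z] by (simp add: abs_mult mult_left_le)
qed

lemma bump_primitive_linear: "\<bar>x\<bar> \<le> 1/2 \<Longrightarrow> bump_primitive x - bump_primitive 0 = x"
proof -
  assume "\<bar>x\<bar> \<le> 1/2"
  moreover obtain z where "min x 0 \<le> z" "z \<le> max x 0" "bump_primitive x - bump_primitive 0 = (x - 0) * bump z"
    using bump_primitive_mvt by blast
  ultimately show ?thesis using bump_eq_1[of z] by auto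
qed

lemma bump_primitive_clamp: "bump_primitive x = bump_primitive (max (-1) (min 1 x))"
proof (cases "x \<le> 1")
  case True
  then show ?thesis by (cases "x \<le> -1") (auto simp: bump_primitive_eq_0)
next
  case False
  obtain z where z: "min x 1 \<le> z" "bump_primitive x - bump_primitive 1 = (x - 1) * bump z"
    using bump_primitive_mvt by blast
  then have "bump z = 0 \<or> z = 1" using False bump_eq_0[of z] by auto
  moreover have "bump 1 = 0"
    by (simp add: bump_def plateau_def step_eq_1)
  ultimately show ?thesis using z False by auto
qed

lemma bump_primitive_diff_le_2: "\<bar>bump_primitive x - bump_primitive y\<bar> \<le> 2"
  using bump_primitive_lipschitz[of "max (-1) (min 1 x)" "max (-1) (min 1 y)"]
  unfolding bump_primitive_clamp[symmetric] by linarith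

text \<open>
  The primitive is constant on either side of \<open>[-1, 1]\<close>, so for large \<open>\<bar>y\<bar>\<close> the increment
  vanishes until \<open>x\<close> comes back to distance \<open>1\<close> of the origin; hence the slope of every chord
  from \<open>y\<close> decays like \<open>1 / \<bar>y\<bar>\<close>.
\<close>

lemma bump_primitive_far:
  assumes "y \<noteq> 0"
  shows "\<bar>bump_primitive x - bump_primitive y\<bar> \<le> 4 * \<bar>x - y\<bar> / \<bar>y\<bar>"
proof -
  consider "\<bar>y\<bar> \<le> 2 * \<bar>x - y\<bar>" | "2 * \<bar>x - y\<bar> < \<bar>y\<bar>" "2 \<le> \<bar>y\<bar>" | "\<bar>y\<bar> < 2" by linarith
  then show ?thesis
  proof cases
    case 1
    then have "2 \<le> 4 * \<bar>x - y\<bar> / \<bar>y\<bar>" using assms by (simp add: field_simps)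
    then show ?thesis using bump_primitive_diff_le_2[of x y] by linarith
  next
    case 2
    then have "max (-1) (min 1 x) = max (-1) (min 1 y)" by (auto simp: abs_if split: if_splits)
    then show ?thesis
      using bump_primitive_clamp[of x] bump_primitive_clamp[of y] by simp
  next
    case 3
    then have "\<bar>x - y\<bar> * \<bar>y\<bar> \<le> \<bar>x - y\<bar> * 4" by (intro mult_left_mono) auto
    then have "\<bar>x - y\<bar> \<le> 4 * \<bar>x - y\<bar> / \<bar>y\<bar>" using assms by (simp add: field_simps)
    then show ?thesis using bump_primitive_lipschitz[of x y] by linarith
  qed
qed

section \<open>Cascades of bumps at a dense set of sites\<close>

text \<open>
  Such radii keep the copy at \<open>q n\<close> inside \<open>(-1, 1)\<close> and small compared with its distance to the
  sites listed before it.
\<close>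

lemma separating_radii:
  fixes q :: "nat \<Rightarrow> real"
  assumes "inj q" "\<And>n. \<bar>q n\<bar> < 1"
  obtains d where "\<And>n. 0 < d n" "\<And>n. d n < 1 - \<bar>q n\<bar>" "\<And>m n. m < n \<Longrightarrow> d n \<le> \<bar>q n - q m\<bar>"
proof -
  define d where "d n = Min (insert ((1 - \<bar>q n\<bar>) / 2) ((\<lambda>m. \<bar>q n - q m\<bar>) ` {..<n}))" for n
  have pos: "0 < d n" for n
    unfolding d_def using assms(2)[of n] injD[OF assms(1), of n] by (subst Min_gr_iff) auto
  have le: "d n \<le> (1 - \<bar>q n\<bar>) / 2" for n
    unfolding d_def by (intro Min_le) auto
  have "d n < 1 - \<bar>q n\<bar>" for n using le[of n] pos[of n] by argo
  moreover have "d n \<le> \<bar>q n - q m\<bar>" if "m < n" for m n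
    unfolding d_def using that by (intro Min_le) auto
  ultimately show ?thesis using that pos by blast
qed

text \<open>
  At every site \<open>q n\<close> bumps of height proportional to \<open>c k\<close> and radius \<open>d n / 4 ^ k\<close> are stacked
  for all \<open>k\<close>.  The bumps with \<open>k \<le> K\<close> are all equal to their full height within distance
  \<open>d n / (2 * 4 ^ K)\<close> of the site, which makes the slope of \<open>w\<close> there close to a multiple of
  \<open>\<Sum>k\<le>K. c k\<close>; the condition \<open>small\<close> keeps the penalties continuous.
\<close>

locale bump_cascade =
  fixes c a q d :: "nat \<Rightarrow> real"
  assumes a: "\<And>k. 0 < a k" "summable a" "(\<Sum>k. a k) \<le> 1"
    and small: "(\<lambda>k. (c k)\<^sup>2 / a k) \<longlonglongrightarrow> 0"
    and q: "inj q" "\<And>n. \<bar>q n\<bar> < 1"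
    and d: "\<And>n. 0 < d n" "\<And>n. d n < 1 - \<bar>q n\<bar>" "\<And>m n. m < n \<Longrightarrow> d n \<le> \<bar>q n - q m\<bar>"
begin

text \<open>
  The share of the quadratic energy reserved for the site \<open>q n\<close>.  Multiplying the heights, the
  weights and the penalty of a bump by one common factor preserves its energy inequality.
\<close>

definition \<epsilon> :: "nat \<Rightarrow> real" where "\<epsilon> n = (1/2) ^ Suc n"

lemma \<epsilon>: "0 < \<epsilon> n" "summable \<epsilon>" "suminf \<epsilon> = 1"
  using power_half_series by (auto simp: \<epsilon>_def[abs_def] sums_iff)

lemma ratio_bounded: obtains D where "0 < D" "\<And>k. (c k)\<^sup>2 / a k \<le> D"
proof -
  have "Bseq (\<lambda>k. (c k)\<^sup>2 / a k)"
    using small by (intro convergent_imp_Bseq convergentI)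
  then obtain D where "0 < D" "\<And>k. norm ((c k)\<^sup>2 / a k) \<le> D"
    unfolding Bseq_def by blast
  then show ?thesis
    using that[of D] a(1) by (auto simp: less_imp_le)
qed

lemma c_bounded: obtains C where "0 < C" "\<And>k. \<bar>c k\<bar> \<le> C"
proof -
  obtain D where D: "0 < D" "\<And>k. (c k)\<^sup>2 / a k \<le> D" using ratio_bounded by blast
  have "\<bar>c k\<bar> \<le> sqrt D" for k
  proof -
    have "a k \<le> 1"
      using sum_le_suminf[OF a(2), of "{k}"] a(1,3) by (auto simp: less_imp_le intro: order_trans)
    have "(c k)\<^sup>2 \<le> D * a k" using D(2)[of k] a(1)[of k] by (simp add: field_simps)
    also have "\<dots> \<le> D" using \<open>a k \<le> 1\<close> D(1) by (simp add: mult_left_le)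
    finally show ?thesis by (simp add: real_le_rsqrt)
  qed
  then show ?thesis using that[of "sqrt D"] D(1) by simp
qed

lemma d_le_1: "d n \<le> 1"
  using d(2)[of n] by linarith

lemma summable_ed: "summable (\<lambda>n. \<epsilon> n * d n)"
  using \<epsilon>(1) d(1) d_le_1
  by (intro summable_comparison_test'[OF \<epsilon>(2), of 0]) (auto simp: less_imp_le mult_left_le)

lemma summable_c: "summable (\<lambda>k. \<bar>c k\<bar> / 4 ^ k)"
proof -
  obtain C where C: "0 < C" "\<And>k. \<bar>c k\<bar> \<le> C" using c_bounded by blast
  have "summable (\<lambda>k. C * (1/4 :: real) ^ k)" by (intro summable_mult summable_geometric) simp
  then show ?thesis
    by (rule summable_comparison_test'[where N=0]) (use C in \<open>auto simp: power_divide divide_right_mono\<close>)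
qed

lemma summable_ratio: "summable (\<lambda>k. (c k)\<^sup>2 / a k / 4 ^ k)"
proof -
  obtain D where D: "0 < D" "\<And>k. (c k)\<^sup>2 / a k \<le> D" using ratio_bounded by blast
  have "summable (\<lambda>k. D * (1/4 :: real) ^ k)" by (intro summable_mult summable_geometric) simp
  then show ?thesis
  proof (rule summable_comparison_test'[where N=0])
    fix k
    have "(c k)\<^sup>2 / a k / 4 ^ k \<le> D / 4 ^ k" using D(2) by (intro divide_right_mono) auto
    then show "norm ((c k)\<^sup>2 / a k / 4 ^ k) \<le> D * (1/4) ^ k"
      using a(1)[of k] by (simp add: power_divide less_imp_le)
  qed
qed

text \<open>
  The pairs consisting of a site and a level are enumerated in a single sequence.
\<close>

definition site :: "nat \<Rightarrow> nat" where "site j = fst (prod_decode j)"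

definition level :: "nat \<Rightarrow> nat" where "level j = snd (prod_decode j)"

definition radius :: "nat \<Rightarrow> real" where "radius j = d (site j) / 4 ^ level j"

definition chart :: "nat \<Rightarrow> real \<Rightarrow> real" where "chart j t = (t - q (site j)) / radius j"

definition amplitude :: "nat \<Rightarrow> real" where "amplitude j = \<epsilon> (site j) * c (level j)"

definition weight :: "nat \<Rightarrow> real" where "weight j = \<epsilon> (site j) * a (level j)"

lemma radius: "0 < radius j" "radius j \<le> d (site j)"
  using d(1)[of "site j"] by (auto simp: radius_def divide_le_eq)

sublocale bump_superposition 1
  "\<lambda>j t. amplitude j * radius j * bump_primitive (chart j t)"
  "\<lambda>j t. amplitude j * bump (chart j t)"
  "\<lambda>j t. amplitude j / radius j * bump' (chart j t)"
  weight "\<lambda>j. \<bar>amplitude j\<bar>"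
  "\<lambda>j. q (site j) - radius j" "\<lambda>j. q (site j) + radius j"
proof
  have chart: "(chart j has_real_derivative 1 / radius j) (at t)" for j t
    unfolding chart_def[abs_def] using radius(1)[of j]
    by (auto intro!: derivative_eq_intros)
  show "((\<lambda>t. amplitude j * radius j * bump_primitive (chart j t)) has_real_derivative
      amplitude j * bump (chart j t)) (at t)" for j t
    using DERIV_cmult[OF DERIV_chain2[OF DERIV_bump_primitive chart], of "amplitude j * radius j" j t] radius(1)[of j]
    by simp
  show "((\<lambda>t. amplitude j * bump (chart j t)) has_real_derivative
      amplitude j / radius j * bump' (chart j t)) (at t)" for j t
    using DERIV_cmult[OF DERIV_chain2[OF DERIV_bump chart], of "amplitude j" j t] by simp
  show "continuous_on UNIV (\<lambda>t. amplitude j / radius j * bump' (chart j t))" for j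
    using radius(1)[of j] unfolding chart_def
    by (intro continuous_intros continuous_on_compose2[OF continuous_on_bump'[of UNIV]]) auto
  have inside: "radius j < 1 - \<bar>q (site j)\<bar>" for j
    using radius(2)[of j] d(2)[of "site j"] by linarith
  show "- 1 < q (site j) - radius j" "q (site j) + radius j < 1" for j
    using inside[of j] by linarith+
  show "q (site j) - radius j < q (site j) + radius j" for j
    using radius(1)[of j] by simp
  show "amplitude j * bump (chart j t) = 0" if "t \<notin> {q (site j) - radius j..q (site j) + radius j}" for j t
  proof -
    have "chart j t \<notin> {-1..1}"
      using that radius(1)[of j] by (auto simp: chart_def field_simps)
    then show ?thesis by (simp add: bump_eq_0)
  qed
  show "\<bar>amplitude j * bump (chart j t)\<bar> \<le> \<bar>amplitude j\<bar>" for j t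
    using bump_bounds[of "chart j t"] by (simp add: abs_mult mult_left_le)
  show "amplitude j * radius j * bump_primitive (chart j (- 1)) = 0" for j
  proof -
    have "- 1 - q (site j) \<le> - 1 * radius j" using inside[of j] by linarith
    then have "chart j (- 1) \<le> - 1"
      unfolding chart_def using radius(1)[of j] by (simp only: pos_divide_le_eq)
    then show ?thesis by (simp add: bump_primitive_eq_0)
  qed
  show "0 < weight j" for j using \<epsilon>(1) a(1) by (simp add: weight_def)
  show "summable weight" "suminf weight \<le> 1"
    using summable_prod_decode[of \<epsilon> a] \<epsilon> a
    by (auto simp: weight_def[abs_def] site_def level_def less_imp_le)
  show "summable (\<lambda>j. \<bar>amplitude j\<bar> * (q (site j) + radius j - (q (site j) - radius j)))"
  proof -
    have "summable (\<lambda>j. 2 * ((\<epsilon> (site j) * d (site j)) * (\<bar>c (level j)\<bar> / 4 ^ level j)))"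
      unfolding site_def level_def using \<epsilon>(1) d(1)
      by (intro summable_mult summable_prod_decode summable_ed summable_c) (auto simp: less_imp_le)
    then show ?thesis
      using abs_of_pos[OF \<epsilon>(1)] by (simp add: amplitude_def radius_def abs_mult mult_ac)
  qed
  show "summable (\<lambda>j. \<bar>amplitude j\<bar>\<^sup>2 * (q (site j) + radius j - (q (site j) - radius j)) / weight j)"
  proof -
    have "summable (\<lambda>j. 2 * ((\<epsilon> (site j) * d (site j)) * ((c (level j))\<^sup>2 / a (level j) / 4 ^ level j)))"
      unfolding site_def level_def using \<epsilon>(1) d(1) a(1)
      by (intro summable_mult summable_prod_decode summable_ed summable_ratio) (auto simp: less_imp_le)
    moreover have "2 * ((\<epsilon> (site j) * d (site j)) * ((c (level j))\<^sup>2 / a (level j) / 4 ^ level j))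
        = \<bar>amplitude j\<bar>\<^sup>2 * (q (site j) + radius j - (q (site j) - radius j)) / weight j" for j
      using \<epsilon>(1)[of "site j"]
      by (simp add: amplitude_def radius_def weight_def power_mult_distrib power2_eq_square mult_ac)
    ultimately show ?thesis by simp
  qed
qed simp

text \<open>
  The penalty of the bump of level \<open>k\<close> at a site, in coordinates in which the site is \<open>0\<close> and its
  radius is \<open>1\<close>.  It is nonzero only on the two flanks of the bump, where \<open>4 ^ k * \<bar>x\<bar>\<close> lies
  between \<open>1/2\<close> and \<open>1\<close>.
\<close>

definition penalty :: "nat \<Rightarrow> real \<times> real \<Rightarrow> real" where
  "penalty k = (\<lambda>(x, y). 2 * \<bar>c k\<bar> * \<bar>bump' (4 ^ k * x)\<bar> * min (4 ^ k * \<bar>y\<bar>) (8 * \<bar>c k\<bar> / a k))"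

definition profile :: "real \<times> real \<Rightarrow> real" where "profile p = (\<Sum>k. penalty k p)"

definition \<phi> :: "real \<times> real \<Rightarrow> real" where
  "\<phi> = (\<lambda>p. \<Sum>n. \<epsilon> n * profile ((fst p - q n) / d n, snd p / d n))"

lemma penalty_nonneg: "0 \<le> penalty k p"
  using a(1)[of k] by (auto simp: penalty_def less_imp_le split: prod.splits)

lemma penalty_le: "\<bar>penalty k p\<bar> \<le> 64 * ((c k)\<^sup>2 / a k)"
proof -
  obtain x y where p: "p = (x, y)" by force
  have "penalty k p \<le> 2 * \<bar>c k\<bar> * 4 * (8 * \<bar>c k\<bar> / a k)"
    unfolding p penalty_def prod.case using bump'_bound a(1)[of k]
    by (intro mult_mono) (auto simp: less_imp_le)
  also have "\<dots> = 64 * ((c k)\<^sup>2 / a k)" by (simp add: power2_eq_square)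
  finally show ?thesis using penalty_nonneg by simp
qed

text \<open>
  The flanks of different levels do not meet, since the radii shrink by the factor \<open>4\<close> while a
  flank extends only by the factor \<open>2\<close>.
\<close>

lemma penalty_disjoint:
  assumes "penalty i p \<noteq> 0" "penalty j p \<noteq> 0"
  shows "i = j"
proof -
  have *: False if "penalty i p \<noteq> 0" "penalty j p \<noteq> 0" "i < j" for i j
  proof -
    obtain x y where p: "p = (x, y)" by force
    have "bump' (4 ^ i * x) \<noteq> 0" "bump' (4 ^ j * x) \<noteq> 0"
      using that by (auto simp: p penalty_def)
    then have x: "1/2 < 4 ^ i * \<bar>x\<bar>" "4 ^ j * \<bar>x\<bar> < 1"
      using bump'_nonzeroD[of "4 ^ i * x"] bump'_nonzeroD[of "4 ^ j * x"] by (auto simp: abs_mult)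
    have "(4::real) ^ Suc i \<le> 4 ^ j" using that(3) by (intro power_increasing) auto
    then have "4 ^ Suc i * \<bar>x\<bar> \<le> 4 ^ j * \<bar>x\<bar>" by (rule mult_right_mono) simp
    then show False using x by simp
  qed
  show ?thesis using *[of i j] *[of j i] assms by (cases i j rule: linorder_cases) auto
qed

lemma summable_penalty: "summable (\<lambda>k. penalty k p)"
  using suminf_of_at_most_one_nonzero[of "\<lambda>k. penalty k p"] penalty_disjoint by metis

lemma profile_bounded: obtains D where "\<And>p. 0 \<le> profile p" "\<And>p. profile p \<le> D"
proof -
  obtain D where D: "0 < D" "\<And>k. (c k)\<^sup>2 / a k \<le> D" using ratio_bounded by blast
  have "profile p \<le> 64 * D" for p
  proof -
    obtain k where "profile p = penalty k p"
      using suminf_of_at_most_one_nonzero[of "\<lambda>k. penalty k p"] penalty_disjoint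
      unfolding profile_def by metis
    then show ?thesis using penalty_le[of k p] D(2)[of k] by linarith
  qed
  moreover have "0 \<le> profile p" for p
    unfolding profile_def by (intro suminf_nonneg summable_penalty penalty_nonneg)
  ultimately show ?thesis using that by blast
qed

lemma continuous_profile: "continuous_on UNIV profile"
  unfolding profile_def[abs_def]
proof (rule continuous_on_suminf_disjoint_supports[OF _ penalty_le _ penalty_disjoint])
  show "continuous_on UNIV (penalty k)" for k
    unfolding penalty_def case_prod_beta
    by (intro continuous_intros continuous_on_compose2[OF continuous_on_bump'[of UNIV]]) auto
  show "(\<lambda>k. 64 * ((c k)\<^sup>2 / a k)) \<longlonglongrightarrow> 0"
    using tendsto_mult_left[OF small, of 64] by simp
qed

lemma summable_profile: "summable (\<lambda>n. \<epsilon> n * profile (P n))"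
  and profile_term: "\<exists>D. \<forall>n p. \<bar>\<epsilon> n * profile p\<bar> \<le> \<epsilon> n * D"
proof -
  obtain D where D: "\<And>p. 0 \<le> profile p" "\<And>p. profile p \<le> D" using profile_bounded by blast
  have le: "\<bar>\<epsilon> n * profile p\<bar> \<le> \<epsilon> n * D" for n p
    using D \<epsilon>(1)[of n] by (simp add: abs_mult)
  then show "\<exists>D. \<forall>n p. \<bar>\<epsilon> n * profile p\<bar> \<le> \<epsilon> n * D" by blast
  show "summable (\<lambda>n. \<epsilon> n * profile (P n))"
    by (rule summable_comparison_test'[OF summable_mult2[OF \<epsilon>(2), of D], of 0]) (use le in auto)
qed

lemma continuous_\<phi>: "continuous_on UNIV \<phi>"
proof (rule uniform_limit_theorem)
  show "eventually (\<lambda>N. continuous_on UNIV (\<lambda>p. \<Sum>n<N. \<epsilon> n * profile ((fst p - q n) / d n, snd p / d n))) sequentially"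
    using d(1)
    by (intro always_eventually allI continuous_intros continuous_on_compose2[OF continuous_profile])
      (auto simp: less_imp_neq[symmetric])
  obtain D where "\<And>n p. \<bar>\<epsilon> n * profile p\<bar> \<le> \<epsilon> n * D" using profile_term by blast
  then have "uniform_limit UNIV (\<lambda>N p. \<Sum>n<N. \<epsilon> n * profile ((fst p - q n) / d n, snd p / d n))
      (\<lambda>p. \<Sum>n. \<epsilon> n * profile ((fst p - q n) / d n, snd p / d n)) sequentially"
    by (intro Weierstrass_m_test[where M="\<lambda>n. \<epsilon> n * D"] summable_mult2 \<epsilon>(2)) simp
  then show "uniform_limit UNIV (\<lambda>N p. \<Sum>n<N. \<epsilon> n * profile ((fst p - q n) / d n, snd p / d n)) \<phi> sequentially"
    by (simp add: \<phi>_def)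
qed simp

lemma \<phi>_zero: "\<phi> (t, 0) = 0"
proof -
  have "penalty k (x, 0) = 0" for k x
    using a(1)[of k] by (simp add: penalty_def less_imp_le min_absorb1)
  then show ?thesis by (simp add: \<phi>_def profile_def)
qed

text \<open>
  In the coordinates of its site the capped penalty required for the \<open>j\<close>-th bump is exactly
  \<open>\<epsilon>\<close> times \<open>penalty\<close>, the cap being \<open>8 \<bar>c k\<bar> / a k\<close> times the radius of the bump.
\<close>

lemma \<phi>_dominates:
  "(\<Sum>j<N. 2 * \<bar>amplitude j / radius j * bump' (chart j t)\<bar> *
      min \<bar>y\<bar> (4 * \<bar>amplitude j\<bar> * (q (site j) + radius j - (q (site j) - radius j)) / weight j)) \<le> \<phi> (t, y)"
  (is "sum ?s _ \<le> _")
proof -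
  define h where "h = (\<lambda>(n, k). \<epsilon> n * penalty k ((t - q n) / d n, y / d n))"
  have h0: "0 \<le> h p" for p
    using \<epsilon>(1) penalty_nonneg by (auto simp: h_def less_imp_le split: prod.splits)
  have "?s j = h (prod_decode j)" for j
  proof -
    let ?n = "site j" and ?k = "level j"
    have pos: "0 < \<epsilon> ?n" "0 < d ?n" "0 < a ?k" using \<epsilon> d a by auto
    have ch: "chart j t = 4 ^ ?k * ((t - q ?n) / d ?n)"
      by (simp add: chart_def radius_def)
    have "?s j = 2 * (\<epsilon> ?n * \<bar>c ?k\<bar> * 4 ^ ?k / d ?n * \<bar>bump' (chart j t)\<bar>) *
        min \<bar>y\<bar> (8 * \<bar>c ?k\<bar> / a ?k * (d ?n / 4 ^ ?k))"
      using pos by (simp add: abs_mult amplitude_def radius_def weight_def mult_ac)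
    also have "\<dots> = \<epsilon> ?n * (2 * \<bar>c ?k\<bar> * \<bar>bump' (chart j t)\<bar> *
        (4 ^ ?k / d ?n * min \<bar>y\<bar> (8 * \<bar>c ?k\<bar> / a ?k * (d ?n / 4 ^ ?k))))"
      by simp
    also have "4 ^ ?k / d ?n * min \<bar>y\<bar> (8 * \<bar>c ?k\<bar> / a ?k * (d ?n / 4 ^ ?k))
        = min (4 ^ ?k / d ?n * \<bar>y\<bar>) (4 ^ ?k / d ?n * (8 * \<bar>c ?k\<bar> / a ?k * (d ?n / 4 ^ ?k)))"
      using pos by (intro min_mult_distrib_left[THEN trans]) simp
    also have "\<dots> = min (4 ^ ?k * \<bar>y / d ?n\<bar>) (8 * \<bar>c ?k\<bar> / a ?k)"
      using pos by simp
    also have "\<epsilon> ?n * (2 * \<bar>c ?k\<bar> * \<bar>bump' (chart j t)\<bar> * min (4 ^ ?k * \<bar>y / d ?n\<bar>) (8 * \<bar>c ?k\<bar> / a ?k))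
        = h (prod_decode j)"
      by (simp add: h_def penalty_def case_prod_beta site_def[symmetric] level_def[symmetric] ch)
    finally show ?thesis .
  qed
  then have "sum ?s {..<N} = (\<Sum>j<N. h (prod_decode j))" by simp
  also have "\<dots> \<le> (\<Sum>n<N. \<Sum>k<N. h (n, k))"
    by (rule sum_prod_decode_le[OF h0])
  also have "\<dots> \<le> (\<Sum>n<N. \<epsilon> n * profile ((t - q n) / d n, y / d n))"
  proof (rule sum_mono)
    fix n
    have "(\<Sum>k<N. penalty k ((t - q n) / d n, y / d n)) \<le> profile ((t - q n) / d n, y / d n)"
      unfolding profile_def by (intro sum_le_suminf summable_penalty) (auto intro: penalty_nonneg)
    then show "(\<Sum>k<N. h (n, k)) \<le> \<epsilon> n * profile ((t - q n) / d n, y / d n)"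
      using \<epsilon>(1)[of n] by (simp add: h_def sum_distrib_left[symmetric])
  qed
  also have "\<dots> \<le> \<phi> (t, y)"
  proof -
    obtain D where "\<And>p. 0 \<le> profile p" using profile_bounded by blast
    then show ?thesis
      unfolding \<phi>_def fst_conv snd_conv using \<epsilon>(1)
      by (intro sum_le_suminf summable_profile) (auto simp: less_imp_le)
  qed
  finally show ?thesis .
qed

text \<open>
  Let \<open>h = d n / (2 * 4 ^ K)\<close>.  The bumps at \<open>q n\<close> of level at most \<open>K\<close> are at full height on
  \<open>[q n, q n + h]\<close> and contribute exactly \<open>\<epsilon> n * (\<Sum>k\<le>K. c k)\<close>.  Those of higher level have
  radius at most \<open>h / 2\<close>, and their contributions form a geometric series.  A bump at another
  site \<open>q m\<close> contributes at most \<open>4 \<epsilon> m \<bar>c k\<bar>\<close> times the ratio of its radius to the distance of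
  the sites, which is summable over \<open>m\<close> because \<open>d m \<le> \<bar>q n - q m\<bar>\<close> for \<open>m > n\<close>.
\<close>

lemma difference_quotient_estimate:
  obtains R where "\<And>K. \<bar>(w (q n + d n / (2 * 4 ^ K)) - w (q n)) / (d n / (2 * 4 ^ K)) - \<epsilon> n * (\<Sum>k\<le>K. c k)\<bar> \<le> R"
proof -
  obtain C where C: "0 < C" "\<And>k. \<bar>c k\<bar> \<le> C" using c_bounded by blast
  \<comment> \<open>For \<open>m = n\<close> the denominator is \<open>0\<close> and so is \<open>X m\<close>.\<close>
  define X where "X m = \<epsilon> m * d m / \<bar>q n - q m\<bar>" for m
  define Y where "Y k = 4 * (\<bar>c k\<bar> / 4 ^ k)" for k
  have X0: "0 \<le> X m" for m using \<epsilon>(1)[of m] d(1)[of m] by (simp add: X_def)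
  have Y0: "0 \<le> Y k" for k by (simp add: Y_def)
  have sX: "summable X"
  proof (rule summable_comparison_test'[OF \<epsilon>(2), of "Suc n"])
    fix m assume "Suc n \<le> m"
    then have "d m \<le> \<bar>q n - q m\<bar>" using d(3)[of n m] by (simp add: abs_minus_commute)
    then have "d m / \<bar>q n - q m\<bar> \<le> 1" using d(1)[of m] by (simp add: divide_le_eq)
    then have "\<epsilon> m * (d m / \<bar>q n - q m\<bar>) \<le> \<epsilon> m * 1" using \<epsilon>(1)[of m] by (intro mult_left_mono) auto
    then have "X m \<le> \<epsilon> m" by (simp add: X_def)
    then show "norm (X m) \<le> \<epsilon> m" using X0[of m] by simp
  qed
  have sY: "summable Y" unfolding Y_def by (intro summable_mult summable_c)
  show ?thesis
  proof (rule that)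
    fix K :: nat
    define h where "h = d n / (2 * 4 ^ K)"
    have h: "0 < h" using d(1) by (simp add: h_def)
    have hd: "h \<le> d n"
    proof -
      have "(1::real) \<le> 2 * 4 ^ K" using one_le_power[of "4::real" K] by linarith
      then show ?thesis unfolding h_def using d(1)[of n] by (simp add: divide_le_eq mult_le_cancel_left1)
    qed
    have t: "q n + h \<in> {- 1..1}" "q n \<in> {- 1..1}"
      using h hd d(2)[of n] q(2)[of n] by (auto simp: abs_if split: if_splits)
    define Q where "Q j = amplitude j * radius j *
      (bump_primitive (chart j (q n + h)) - bump_primitive (chart j (q n))) / h" for j
    have "(\<lambda>j. (amplitude j * radius j * bump_primitive (chart j (q n + h)) -
        amplitude j * radius j * bump_primitive (chart j (q n))) / h) sums ((w (q n + h) - w (q n)) / h)"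
      unfolding w_def using t by (intro sums_divide sums_diff summable_sums summable_B) auto
    then have Q: "Q sums ((w (q n + h) - w (q n)) / h)"
      unfolding Q_def by (simp add: right_diff_distrib)
    \<comment> \<open>The bound for the bumps at \<open>q n\<close> is written as a product of a function of the site and one
      of the level, like that for the other sites, so that double series factorise.\<close>
    define x where "x m = (if m = n then 1 else 0 :: real)" for m
    define y where "y k = (if k \<le> K then c k else 0)" for k
    define u where "u k = (if k \<le> K then 0 else C * 4 ^ K / 4 ^ k)" for k
    define main where "main j = \<epsilon> n * (x (site j) * y (level j))" for j
    have "main sums (\<Sum>j\<in>prod_encode ` ({n} \<times> {..K}). main j)"
    proof (rule sums_finite)
      fix j assume "j \<notin> prod_encode ` ({n} \<times> {..K})"
      then have "prod_decode j \<notin> {n} \<times> {..K}"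
        using imageI[of "prod_decode j" "{n} \<times> {..K}" prod_encode] by auto
      then have "site j \<noteq> n \<or> \<not> level j \<le> K"
        by (simp add: site_def level_def mem_Times_iff)
      then show "main j = 0" by (auto simp: main_def x_def y_def)
    qed simp
    also have "(\<Sum>j\<in>prod_encode ` ({n} \<times> {..K}). main j) = (\<Sum>p\<in>{n} \<times> {..K}. main (prod_encode p))"
      by (simp add: sum.reindex inj_prod_encode)
    also have "\<dots> = (\<Sum>(m, k)\<in>{n} \<times> {..K}. \<epsilon> n * c k)"
      by (rule sum.cong) (auto simp: main_def x_def y_def site_def level_def)
    also have "\<dots> = \<epsilon> n * (\<Sum>k\<le>K. c k)"
      by (simp add: sum.cartesian_product[symmetric] sum_distrib_left)
    finally have main: "main sums (\<epsilon> n * (\<Sum>k\<le>K. c k))" .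
    have err: "\<bar>Q j - main j\<bar> \<le> X (site j) * Y (level j) + 4 * \<epsilon> n * (x (site j) * u (level j))" for j
    proof (cases "site j = n")
      case True
      define s where "s = h / radius j"
      have r: "0 < radius j" by (rule radius)
      have ch: "chart j (q n + h) = s" "chart j (q n) = 0"
        using True by (simp_all add: chart_def s_def)
      have amp: "amplitude j = \<epsilon> n * c (level j)" using True by (simp add: amplitude_def)
      have s: "s = 4 ^ level j / (2 * 4 ^ K)"
        using True d(1)[of n] by (simp add: s_def h_def radius_def)
      have XY: "0 \<le> X (site j) * Y (level j)" using X0 Y0 by simp
      show ?thesis
      proof (cases "level j \<le> K")
        case lev: True
        then have "(4::real) ^ level j \<le> 4 ^ K" by (intro power_increasing) auto
        then have "\<bar>s\<bar> \<le> 1/2" by (simp add: s divide_le_eq)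
        then have "Q j = amplitude j * radius j * s / h"
          by (simp add: Q_def ch bump_primitive_linear)
        also have "\<dots> = main j"
          using r h lev True by (simp add: s_def amp main_def x_def y_def)
        finally show ?thesis using XY lev by (simp add: u_def)
      next
        case lev: False
        have "\<bar>Q j\<bar> = \<epsilon> n * \<bar>c (level j)\<bar> * radius j * \<bar>bump_primitive s - bump_primitive 0\<bar> / h"
          using \<epsilon>(1)[of n] r h by (simp add: Q_def ch amp abs_mult)
        also have "\<dots> \<le> \<epsilon> n * C * radius j * 2 / h"
          using \<epsilon>(1)[of n] r h C(1) C(2)[of "level j"] bump_primitive_diff_le_2[of s 0]
          by (intro divide_right_mono mult_mono) (auto simp: less_imp_le)
        also have "\<dots> = 4 * \<epsilon> n * (C * 4 ^ K / 4 ^ level j)"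
          using d(1)[of n] True by (simp add: radius_def h_def)
        finally show ?thesis using XY lev True by (simp add: main_def y_def x_def u_def)
      qed
    next
      case False
      let ?m = "site j" and ?k = "level j"
      have D: "0 < \<bar>q n - q ?m\<bar>" using False injD[OF q(1), of n ?m] by auto
      have r: "0 < radius j" by (rule radius)
      have ch: "\<bar>chart j (q n + h) - chart j (q n)\<bar> = h / radius j" "\<bar>chart j (q n)\<bar> = \<bar>q n - q ?m\<bar> / radius j"
        using r h by (simp_all add: chart_def diff_divide_distrib[symmetric])
      have "chart j (q n) \<noteq> 0" using D r by (auto simp: chart_def)
      from bump_primitive_far[OF this, of "chart j (q n + h)"]
      have far: "\<bar>bump_primitive (chart j (q n + h)) - bump_primitive (chart j (q n))\<bar> \<le> 4 * h / \<bar>q n - q ?m\<bar>"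
        unfolding ch using r by simp
      have "\<bar>Q j\<bar> = \<epsilon> ?m * \<bar>c ?k\<bar> * radius j *
          \<bar>bump_primitive (chart j (q n + h)) - bump_primitive (chart j (q n))\<bar> / h"
        using \<epsilon>(1)[of ?m] r h by (simp add: Q_def amplitude_def abs_mult)
      also have "\<dots> \<le> \<epsilon> ?m * \<bar>c ?k\<bar> * radius j * (4 * h / \<bar>q n - q ?m\<bar>) / h"
        using far \<epsilon>(1)[of ?m] r h by (intro divide_right_mono mult_left_mono) (auto simp: less_imp_le)
      also have "\<dots> = X ?m * Y ?k"
        using h by (simp add: X_def Y_def radius_def mult_ac)
      finally show ?thesis using False by (simp add: main_def x_def)
    qed
    have sx: "summable x" "suminf x = 1"
      using sums_finite[of "{n}" x] by (auto simp: x_def sums_iff)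
    have u0: "0 \<le> u k" for k using C(1) by (simp add: u_def)
    have shift: "u (i + Suc K) = C * (1/4) ^ Suc i" for i
      by (simp add: u_def power_add power_divide)
    have su': "(\<lambda>i. u (i + Suc K)) sums (C * (1 / 3))"
      unfolding shift using sums_mult[OF sums_mult[OF geometric_sums[of "1/4 :: real"], of "1/4"], of C] by simp
    have u: "summable u" "suminf u = C * (1 / 3)"
    proof -
      show "summable u" using su' summable_iff_shift[of u "Suc K"] by (simp add: sums_iff)
      from suminf_split_initial_segment[OF this, of "Suc K"] show "suminf u = C * (1 / 3)"
        using su' by (simp add: sums_iff u_def)
    qed
    note p1 = summable_prod_decode[OF X0 sX Y0 sY, folded site_def level_def]
    have x0: "0 \<le> x m" for m by (simp add: x_def)
    note p2 = summable_prod_decode[OF x0 sx(1) u0 u(1), folded site_def level_def]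
    let ?E = "\<lambda>j. X (site j) * Y (level j) + 4 * \<epsilon> n * (x (site j) * u (level j))"
    have sE: "summable ?E" by (intro summable_add summable_mult p1 p2)
    have sdiff: "(\<lambda>j. Q j - main j) sums ((w (q n + h) - w (q n)) / h - \<epsilon> n * (\<Sum>k\<le>K. c k))"
      by (rule sums_diff[OF Q main])
    have sabs: "summable (\<lambda>j. \<bar>Q j - main j\<bar>)"
      by (rule summable_comparison_test'[OF sE, of 0]) (use err in simp)
    have "\<bar>(w (q n + h) - w (q n)) / h - \<epsilon> n * (\<Sum>k\<le>K. c k)\<bar> \<le> (\<Sum>j. \<bar>Q j - main j\<bar>)"
      using summable_rabs[OF sabs] sdiff by (simp add: sums_iff)
    also have "\<dots> \<le> suminf ?E"
      by (rule suminf_le[OF err sabs sE])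
    also have "\<dots> = (\<Sum>j. X (site j) * Y (level j)) + 4 * \<epsilon> n * (\<Sum>j. x (site j) * u (level j))"
      using p1(1) p2(1) by (simp add: suminf_add[symmetric] suminf_mult summable_mult)
    also have "\<dots> \<le> suminf X * suminf Y + 4 * \<epsilon> n * (1 * (C * (1 / 3)))"
      using p1(2) p2(2) sx(2) u(2) \<epsilon>(1)[of n] by (intro add_mono mult_left_mono) auto
    finally show "\<bar>(w (q n + d n / (2 * 4 ^ K)) - w (q n)) / (d n / (2 * 4 ^ K)) - \<epsilon> n * (\<Sum>k\<le>K. c k)\<bar>
        \<le> suminf X * suminf Y + 4 * \<epsilon> n * (1 * (C * (1 / 3)))"
      by (simp add: h_def)
  qed
qed

lemma Dini_infinite:
  assumes up: "\<And>C N. \<exists>K\<ge>N. C < (\<Sum>k\<le>K. c k)" and down: "\<And>C N. \<exists>K\<ge>N. (\<Sum>k\<le>K. c k) < C"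
  shows "upper_Dini w (q n) = \<infinity>" "lower_Dini w (q n) = - \<infinity>"
proof -
  define h where "h K = d n / (2 * 4 ^ K)" for K :: nat
  have h: "0 < h K" for K using d(1) by (simp add: h_def)
  have h0: "h \<longlonglongrightarrow> 0" unfolding h_def using d(1)[of n] by real_asymp
  obtain R where R: "\<And>K. \<bar>(w (q n + h K) - w (q n)) / h K - \<epsilon> n * (\<Sum>k\<le>K. c k)\<bar> \<le> R"
    using difference_quotient_estimate[of n] unfolding h_def by blast
  have near: "\<exists>N. \<forall>K\<ge>N. \<bar>q n + h K - q n\<bar> < \<delta>" if "0 < \<delta>" for \<delta>
    using LIMSEQ_D[OF h0 that] by simp
  show "upper_Dini w (q n) = \<infinity>"
    unfolding upper_Dini_def
  proof (rule Limsup_at_eq_PInfty)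
    fix C \<delta> :: real assume "0 < \<delta>"
    then obtain N where N: "\<And>K. K \<ge> N \<Longrightarrow> \<bar>q n + h K - q n\<bar> < \<delta>" using near by blast
    obtain K where K: "K \<ge> N" "(C + R) / \<epsilon> n < (\<Sum>k\<le>K. c k)" using up by blast
    have "C + R < \<epsilon> n * (\<Sum>k\<le>K. c k)" using K(2) \<epsilon>(1)[of n] by (simp add: divide_less_eq mult.commute)
    then have "C < (w (q n + h K) - w (q n)) / (q n + h K - q n)" using R[of K] by (simp add: abs_le_iff)
    then show "\<exists>s. s \<noteq> q n \<and> \<bar>s - q n\<bar> < \<delta> \<and> C < (w s - w (q n)) / (s - q n)"
      using N[OF K(1)] h[of K] by (intro exI[of _ "q n + h K"]) auto
  qed
  show "lower_Dini w (q n) = - \<infinity>"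
    unfolding lower_Dini_def
  proof (rule Liminf_at_eq_MInfty)
    fix C \<delta> :: real assume "0 < \<delta>"
    then obtain N where N: "\<And>K. K \<ge> N \<Longrightarrow> \<bar>q n + h K - q n\<bar> < \<delta>" using near by blast
    obtain K where K: "K \<ge> N" "(\<Sum>k\<le>K. c k) < (C - R) / \<epsilon> n" using down by blast
    have "\<epsilon> n * (\<Sum>k\<le>K. c k) < C - R" using K(2) \<epsilon>(1)[of n] by (simp add: less_divide_eq mult.commute)
    then have "(w (q n + h K) - w (q n)) / (q n + h K - q n) < C" using R[of K] by (simp add: abs_le_iff)
    then show "\<exists>s. s \<noteq> q n \<and> \<bar>s - q n\<bar> < \<delta> \<and> (w s - w (q n)) / (s - q n) < C"
      using N[OF K(1)] h[of K] by (intro exI[of _ "q n + h K"]) auto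
  qed
qed

end

section \<open>The minimizer with infinite Dini derivatives\<close>

theorem theorem2:
  shows "\<exists>(T::real) (w :: real \<Rightarrow> real) (\<phi> :: real \<times> real \<Rightarrow> real).
    T > 0 \<and>
    w \<in> sobolev 2 (-T) T \<and>
    continuous_on ({-T..T} \<times> UNIV) \<phi> \<and>
    (\<forall>t\<in>{-T..T}. \<forall>y. 0 \<le> \<phi> (t, y)) \<and>
    continuous_on ({-T..T} \<times> UNIV \<times> UNIV) (lagrangian \<phi> w) \<and>
    (\<forall>u\<in>sobolev 1 (-T) T.
       (\<lambda>t. lagrangian \<phi> w (t, u t, weak_deriv (-T) T u t))
         \<in> borel_measurable (lebesgue_on {-T<..<T})) \<and>
    minimizer_over (int_functional T (lagrangian \<phi> w)) (admissible T (w (-T)) (w T)) w \<and>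
    {-T..T} \<subseteq> closure {t \<in> {-T<..<T}. upper_Dini w t = \<infinity> \<and> lower_Dini w t = - \<infinity>}"
proof -
  obtain c a :: "nat \<Rightarrow> real" where a: "\<And>k. 0 < a k" "summable a" "(\<Sum>k. a k) \<le> 1"
    and small: "(\<lambda>k. (c k)\<^sup>2 / a k) \<longlonglongrightarrow> 0"
    and up: "\<And>C N. \<exists>K\<ge>N. C < (\<Sum>k\<le>K. c k)" and down: "\<And>C N. \<exists>K\<ge>N. (\<Sum>k\<le>K. c k) < C"
    by (rule oscillating_series) (rule that)
  obtain q :: "nat \<Rightarrow> real" where sites: "inj q" "range q \<subseteq> {-1<..<1}" "closure (range q) = {-1..1}"
    by (rule dense_sequence) (rule that)
  have q1: "\<bar>q n\<bar> < 1" for n using subsetD[OF sites(2) rangeI[of q n]] by (simp add: abs_less_iff)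
  obtain d where d: "\<And>n. 0 < d n" "\<And>n. d n < 1 - \<bar>q n\<bar>" "\<And>m n. m < n \<Longrightarrow> d n \<le> \<bar>q n - q m\<bar>"
    by (rule separating_radii[OF sites(1) q1]) (rule that)
  interpret bump_cascade c a q d
    using a small sites(1) q1 d by unfold_locales
  have c\<phi>: "continuous_on ({-1..1} \<times> UNIV) \<phi>"
    using continuous_\<phi> by (rule continuous_on_subset) simp
  have "continuous_on ({-1..1} \<times> UNIV \<times> UNIV) (\<lambda>p. \<phi> (fst p, fst (snd p) - w (fst p)) + (snd (snd p))\<^sup>2)"
    by (intro continuous_intros continuous_on_compose2[OF continuous_\<phi>]
        continuous_on_compose2[OF continuous_w]) auto
  then have cL: "continuous_on ({-1..1} \<times> UNIV \<times> UNIV) (lagrangian \<phi> w)"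
    by (simp add: lagrangian_def case_prod_beta)
  have nonneg: "0 \<le> \<phi> (t, y)" for t y
    using \<phi>_dominates[of t y 0] by simp
  have "range q \<subseteq> {t \<in> {-1<..<1}. upper_Dini w t = \<infinity> \<and> lower_Dini w t = - \<infinity>}"
  proof
    fix t assume "t \<in> range q"
    then obtain n where "t = q n" by auto
    then show "t \<in> {t \<in> {-1<..<1}. upper_Dini w t = \<infinity> \<and> lower_Dini w t = - \<infinity>}"
      using Dini_infinite[OF up down, of n] q1[of n] by (simp add: abs_less_iff)
  qed
  from closure_mono[OF this]
  have dense: "{-1..1} \<subseteq> closure {t \<in> {-1<..<1}. upper_Dini w t = \<infinity> \<and> lower_Dini w t = - \<infinity>}"
    unfolding sites(3) .
  show ?thesis
  proof (intro exI[of _ 1] exI[of _ w] exI[of _ \<phi>] conjI ballI allI)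
    show "(\<lambda>t. lagrangian \<phi> w (t, u t, weak_deriv (- 1) 1 u t)) \<in> borel_measurable M"
      if "u \<in> sobolev 1 (- 1) 1" for u
      by (rule lagrangian_measurable(1)[OF c\<phi> that])
    show "minimizer_over (int_functional 1 (lagrangian \<phi> w)) (admissible 1 (w (- 1)) (w 1)) w"
      by (rule w_minimizer[OF c\<phi> \<phi>_zero \<phi>_dominates])
    show "0 \<le> \<phi> (t, y)" for t y by (rule nonneg)
    show "continuous_on ({- 1..1} \<times> UNIV \<times> UNIV) (lagrangian \<phi> w)" by (rule cL)
    show "{- 1..1} \<subseteq> closure {t \<in> {- 1<..<1}. upper_Dini w t = \<infinity> \<and> lower_Dini w t = - \<infinity>}"
      by (rule dense)
  qed (simp_all only: w_sobolev(1) c\<phi> zero_less_one)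
qed

end
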